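(* Let $N=\{1,\dots,n\}$ be a finite set of agents, $A$ a finite set of objects with $|A|>|N|$, and $\succ_A=(\succ_a)_{a\in A}$ a priority structure. On the domain $\mathbb{L}^n(A)$ (every object acceptable to every agent), the FPTTC rule $T^{\succ_A}$ is SOSP-implementable if and only if it is a serial dictatorship.
   Context: **Setting.** $N=\{1,\dots,n\}$ is a finite set of agents, $A$ a non-empty finite set of objects, and $a_0\notin A$ the outside option. An allocation is a function $\mu:N\to A\cup\{a_0\}$ with $|\mu^{-1}(a)|\le 1$ for all $a\in A$; $\mathcal{M}$ is the set of allocations. For a finite set $X$, $\mathbb{L}(X)$ is the set of strict linear orders on $X$; a preference is an element $P$ of $\mathbb{L}(A\cup\{a_0\})$, with weak part $R$ ($x\,R\,y$ iff $x\,P\,y$ or $x=y$). By abuse of notation, $\mathbb{L}(A)=\{P\in\mathbb{L}(A\cup\{a_0\}) : a\,P\,a_0 \text{ for all } a\in A\}$, and $\mathbb{L}^n(A)$ is its $n$-fold product. A domain is a product $\mathcal{P}_N=\prod_{i\in N}\mathcal{P}_i$ with $\mathcal{P}_i\subseteq\mathbb{L}(A\cup\{a_0\})$; an assignment rule is a function $f:\mathcal{P}_N\to\mathcal{M}$, and $f_i(P_N)$ is agent $i$'s assignment. Object $a$ is acceptable to $i$ if $a\,P_i\,a_0$. A priority structure is a collection $\succ_A=(\succ_a)_{a\in A}$ with $\succ_a\in\mathbb{L}(N)$; $\tau(\succ,N')$ is the $\succ$-maximal agent in $N'\subseteq N$. **FPTTC rule.** The fixed priority top trading cycles (FPTTC)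 rule $T^{\succ_A}$ associated with $\succ_A$ is computed at a profile $P_N$ in steps. At Step $s$, let $N_s(P_N)$ and $A_s(P_N)$ be the sets of agents and objects remaining after Step $s-1$ (so $N_1(P_N)=N$, $A_1(P_N)=A$). Each $a\in A_s(P_N)$ is owned by $\tau(\succ_a,N_s(P_N))$. Form the directed graph on $N_s(P_N)$ in which each agent $i$ points to the owner of her most preferred acceptable object in $A_s(P_N)$, or to herself if no object in $A_s(P_N)$ is acceptable to her. Each agent in a cycle of this graph (self-loops included) is assigned her most preferred element of $A_s(P_N)\cup\{a_0\}$; assigned agents and assigned objects are removed. The procedure is repeated until all agents or all objects are assigned; any agent unassigned at the end receives $a_0$. **Serial dictatorship.** An assignment rule is a serial dictatorship if there is a fixed ordering of the agents such that, at every profile of the domain, the first agent gets her most preferred element of $A\cup\{a_0\}$, and each subsequent agent in the ordering gets her most preferred element among $a_0$ and the objects not assigned to earlier agents. **Mechanisms.** For a rooted directed tree $T$, let $V(T),E(T),r(T),L(T)$ denote its nodes, edges, root and leaves; $E^{out}(v)$ the outgoing edges of $v$; $s(e)$ the source of $e$. A mechanism on $\mathcal{P}_N$ is a tuple $G=\langle T,\eta^{LA},\eta^{NA},\eta^{EP}\rangle$ where $T$ is a rooted tree, $\eta^{LA}:L(T)\to\mathcal{M}$, $\eta^{NA}:V(T)\setminus L(T)\to N$, and $\eta^{EP}:E(T)\to 2^{\mathbb{L}(A\cup\{a_0\})}\setminus\{\emptyset\}$ such that (a) $\eta^{EP}(e)\cap\eta^{EP}(e')=\emptyset$ for distinct $e,e'$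 with $s(e)=s(e')$; (b) for each $v\in V(T)\setminus L(T)$: if on the path $(v^1,\dots,v^t)$ from $r(T)$ to $v$ there is $t'<t$ with $\eta^{NA}(v^{t'})=\eta^{NA}(v)$ and $\eta^{NA}(v^{s})\ne\eta^{NA}(v)$ for $t'<s<t$, then $\bigcup_{e\in E^{out}(v)}\eta^{EP}(e)=\eta^{EP}(v^{t'},v^{t'+1})$; otherwise $\bigcup_{e\in E^{out}(v)}\eta^{EP}(e)=\mathcal{P}_{\eta^{NA}(v)}$. Each $P_N\in\mathcal{P}_N$ determines a unique root-to-leaf path, following at each node $v$ the outgoing edge $e$ with $P_{\eta^{NA}(v)}\in\eta^{EP}(e)$; $P_N$ passes through the nodes of this path, and $f^G(P_N)=\eta^{LA}(l)$ where $l$ is its leaf. Preferences $P_i,P_i'$ diverge at $v$ if $\eta^{NA}(v)=i$ and they belong to $\eta^{EP}(e),\eta^{EP}(e')$ for two distinct $e,e'\in E^{out}(v)$. **SOSP.** $G$ is SOSP if for all $i\in N$, all $v$ with $\eta^{NA}(v)=i$, and all $P_N,P'_N,\tilde P_N\in\mathcal{P}_N$ passing through $v$ such that $P_i,P'_i$ do not diverge at $v$ and $P_i,\tilde P_i$ diverge at $v$, we have $f^G_i(P'_N)\,R_i\,f^G_i(\tilde P_N)$. An assignment rule $f$ on $\mathcal{P}_N$ is SOSP-implementable if $f=f^G$ for some SOSP mechanism $G$ on $\mathcal{P}_N$. *)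

theory Defs
  imports Main "HOL-Library.FuncSet"
begin

section \<open>Preferences, domains and allocations\<close>

text \<open>\<open>(x, y) \<in> P\<close> reads ``\<open>x\<close> is strictly preferred to \<open>y\<close>''. Without the
  carrier condition, relations differing only outside \<open>X\<close> would represent the same order on \<open>X\<close>.\<close>

definition strict_orders :: "'x set \<Rightarrow> 'x rel set" where
  "strict_orders X = {P. P \<subseteq> X \<times> X \<and> strict_linear_order_on X P}"

definition best :: "'x rel \<Rightarrow> 'x set \<Rightarrow> 'x" where
  "best P X = (THE x. x \<in> X \<and> (\<forall>y\<in>X. y \<noteq> x \<longrightarrow> (x, y) \<in> P))"

definition weakly_prefers :: "'x rel \<Rightarrow> 'x \<Rightarrow> 'x \<Rightarrow> bool" where
  "weakly_prefers P x y \<longleftrightarrow> (x, y) \<in> P \<or> x = y"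

definition all_acceptable :: "'a set \<Rightarrow> 'a \<Rightarrow> 'a rel set" where
  "all_acceptable A a0 = {P \<in> strict_orders (insert a0 A). \<forall>a\<in>A. (a, a0) \<in> P}"

text \<open>Profiles and allocations are extensional functions on the set of agents \<open>N\<close>, so that equality
  of allocations in HOL is equality of functions with domain \<open>N\<close>.\<close>

definition profiles :: "'i set \<Rightarrow> ('i \<Rightarrow> 'a rel set) \<Rightarrow> ('i \<Rightarrow> 'a rel) set" where
  "profiles N D = (\<Pi>\<^sub>E i\<in>N. D i)"

definition allocations :: "'i set \<Rightarrow> 'a set \<Rightarrow> 'a \<Rightarrow> ('i \<Rightarrow> 'a) set" where
  "allocations N A a0 = {\<mu> \<in> N \<rightarrow>\<^sub>E insert a0 A. \<forall>a\<in>A. card {i \<in> N. \<mu> i = a} \<le> 1}"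


section \<open>The fixed priority top trading cycles rule\<close>

text \<open>The step graph when agents \<open>M\<close> and objects \<open>B\<close> remain; object \<open>a\<close> is owned by
  \<open>best (prio a) M\<close>.\<close>

definition ttc_graph ::
  "('a \<Rightarrow> 'i rel) \<Rightarrow> 'a \<Rightarrow> ('i \<Rightarrow> 'a rel) \<Rightarrow> 'i set \<Rightarrow> 'a set \<Rightarrow> 'i rel" where
  "ttc_graph prio a0 P M B =
     {(i, j). i \<in> M \<and>
        j = (let X = {a \<in> B. (a, a0) \<in> P i}
             in if X = {} then i else best (prio (best (P i) X)) M)}"

definition ttc_cyclic ::
  "('a \<Rightarrow> 'i rel) \<Rightarrow> 'a \<Rightarrow> ('i \<Rightarrow> 'a rel) \<Rightarrow> 'i set \<Rightarrow> 'a set \<Rightarrow> 'i set" where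
  "ttc_cyclic prio a0 P M B = {i \<in> M. (i, i) \<in> (ttc_graph prio a0 P M B)\<^sup>+}"

text \<open>Agents and objects remaining after \<open>s\<close> steps. No stopping test is needed: without agents
  nothing happens any more, and without objects each remaining agent points to herself and takes
  \<open>a0\<close>, which is what she receives when the procedure stops.\<close>

fun ttc_remaining ::
  "'i set \<Rightarrow> 'a set \<Rightarrow> 'a \<Rightarrow> ('a \<Rightarrow> 'i rel) \<Rightarrow> ('i \<Rightarrow> 'a rel) \<Rightarrow> nat \<Rightarrow> 'i set \<times> 'a set" where
  "ttc_remaining N A a0 prio P 0 = (N, A)"
| "ttc_remaining N A a0 prio P (Suc s) =
     (let (M, B) = ttc_remaining N A a0 prio P s;
          C = ttc_cyclic prio a0 P M B
      in (M - C, B - (\<lambda>i. best (P i) (insert a0 B)) ` C))"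

definition ttc_assigned_at ::
  "'i set \<Rightarrow> 'a set \<Rightarrow> 'a \<Rightarrow> ('a \<Rightarrow> 'i rel) \<Rightarrow> ('i \<Rightarrow> 'a rel) \<Rightarrow> nat \<Rightarrow> 'i set" where
  "ttc_assigned_at N A a0 prio P s =
     (let (M, B) = ttc_remaining N A a0 prio P s in ttc_cyclic prio a0 P M B)"

definition FPTTC ::
  "'i set \<Rightarrow> 'a set \<Rightarrow> 'a \<Rightarrow> ('a \<Rightarrow> 'i rel) \<Rightarrow> ('i \<Rightarrow> 'a rel) \<Rightarrow> ('i \<Rightarrow> 'a)" where
  "FPTTC N A a0 prio P =
     (\<lambda>i\<in>N. if \<exists>s. i \<in> ttc_assigned_at N A a0 prio P s
            then let s = (THE s. i \<in> ttc_assigned_at N A a0 prio P s)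
                 in best (P i) (insert a0 (snd (ttc_remaining N A a0 prio P s)))
            else a0)"


section \<open>Serial dictatorships\<close>

definition serial_dictatorship ::
  "'i set \<Rightarrow> 'a set \<Rightarrow> 'a \<Rightarrow> ('i \<Rightarrow> 'a rel set) \<Rightarrow> (('i \<Rightarrow> 'a rel) \<Rightarrow> ('i \<Rightarrow> 'a)) \<Rightarrow> bool" where
  "serial_dictatorship N A a0 D f \<longleftrightarrow>
     (\<exists>xs. distinct xs \<and> set xs = N \<and>
       (\<forall>P\<in>profiles N D. \<forall>k<length xs.
          f P (xs ! k) = best (P (xs ! k)) (insert a0 (A - f P ` set (take k xs)))))"


section \<open>Mechanisms\<close>

record ('v, 'i, 'a) mechanism =
  tnodes :: "'v set"
  tedges :: "('v \<times> 'v) set"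
  troot  :: "'v"
  eta_LA :: "'v \<Rightarrow> ('i \<Rightarrow> 'a)"
  eta_NA :: "'v \<Rightarrow> 'i"
  eta_EP :: "'v \<times> 'v \<Rightarrow> 'a rel set"

definition root_path_to :: "('v, 'i, 'a) mechanism \<Rightarrow> 'v list \<Rightarrow> 'v \<Rightarrow> bool" where
  "root_path_to G p v \<longleftrightarrow>
     p \<noteq> [] \<and> hd p = troot G \<and> last p = v \<and> successively (\<lambda>u w. (u, w) \<in> tedges G) p"

text \<open>Finiteness loses no generality. Out-degrees are finite, as the labels of the edges leaving a
  node are disjoint, non-empty sets of orders on a finite set; so an infinite tree has an infinite
  path from the root, and some profile follows that path and never reaches a leaf.\<close>

definition rooted_tree :: "('v, 'i, 'a) mechanism \<Rightarrow> bool" where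
  "rooted_tree G \<longleftrightarrow>
     finite (tnodes G) \<and> troot G \<in> tnodes G \<and> tedges G \<subseteq> tnodes G \<times> tnodes G \<and>
     (\<forall>v\<in>tnodes G. \<exists>!p. root_path_to G p v)"

definition out_edges :: "('v, 'i, 'a) mechanism \<Rightarrow> 'v \<Rightarrow> ('v \<times> 'v) set" where
  "out_edges G v = {e \<in> tedges G. fst e = v}"

definition leaf_nodes :: "('v, 'i, 'a) mechanism \<Rightarrow> 'v set" where
  "leaf_nodes G = {v \<in> tnodes G. out_edges G v = {}}"

text \<open>On the root path \<open>p\<close>, position \<open>k\<close> is the latest one strictly before the end at which the
  agent of the last node also moves.\<close>

definition previous_move :: "('v, 'i, 'a) mechanism \<Rightarrow> 'v list \<Rightarrow> nat \<Rightarrow> bool" where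
  "previous_move G p k \<longleftrightarrow>
     Suc k < length p \<and> eta_NA G (p ! k) = eta_NA G (last p) \<and>
     (\<forall>s. k < s \<and> Suc s < length p \<longrightarrow> eta_NA G (p ! s) \<noteq> eta_NA G (last p))"

definition is_mechanism ::
  "'i set \<Rightarrow> 'a set \<Rightarrow> 'a \<Rightarrow> ('i \<Rightarrow> 'a rel set) \<Rightarrow> ('v, 'i, 'a) mechanism \<Rightarrow> bool" where
  "is_mechanism N A a0 D G \<longleftrightarrow>
     rooted_tree G \<and>
     (\<forall>l\<in>leaf_nodes G. eta_LA G l \<in> allocations N A a0) \<and>
     (\<forall>v\<in>tnodes G - leaf_nodes G. eta_NA G v \<in> N) \<and>
     (\<forall>e\<in>tedges G. eta_EP G e \<subseteq> strict_orders (insert a0 A) \<and> eta_EP G e \<noteq> {}) \<and>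
     (\<forall>e\<in>tedges G. \<forall>e'\<in>tedges G.
        e \<noteq> e' \<and> fst e = fst e' \<longrightarrow> eta_EP G e \<inter> eta_EP G e' = {}) \<and>
     (\<forall>v\<in>tnodes G - leaf_nodes G. \<forall>p. root_path_to G p v \<longrightarrow>
        (\<forall>k. previous_move G p k \<longrightarrow>
           (\<Union>e\<in>out_edges G v. eta_EP G e) = eta_EP G (p ! k, p ! Suc k)) \<and>
        ((\<nexists>k. previous_move G p k) \<longrightarrow>
           (\<Union>e\<in>out_edges G v. eta_EP G e) = D (eta_NA G v)))"

definition passes_through :: "('v, 'i, 'a) mechanism \<Rightarrow> ('i \<Rightarrow> 'a rel) \<Rightarrow> 'v \<Rightarrow> bool" where
  "passes_through G P v \<longleftrightarrow>
     (\<exists>p. root_path_to G p v \<and>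
       (\<forall>k. Suc k < length p \<longrightarrow> P (eta_NA G (p ! k)) \<in> eta_EP G (p ! k, p ! Suc k)))"

definition outcome :: "('v, 'i, 'a) mechanism \<Rightarrow> ('i \<Rightarrow> 'a rel) \<Rightarrow> ('i \<Rightarrow> 'a)" where
  "outcome G P = eta_LA G (THE l. l \<in> leaf_nodes G \<and> passes_through G P l)"

definition diverge :: "('v, 'i, 'a) mechanism \<Rightarrow> 'i \<Rightarrow> 'a rel \<Rightarrow> 'a rel \<Rightarrow> 'v \<Rightarrow> bool" where
  "diverge G i Q Q' v \<longleftrightarrow>
     eta_NA G v = i \<and>
     (\<exists>e\<in>out_edges G v. \<exists>e'\<in>out_edges G v. e \<noteq> e' \<and> Q \<in> eta_EP G e \<and> Q' \<in> eta_EP G e')"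

definition SOSP ::
  "'i set \<Rightarrow> ('i \<Rightarrow> 'a rel set) \<Rightarrow> ('v, 'i, 'a) mechanism \<Rightarrow> bool" where
  "SOSP N D G \<longleftrightarrow>
     (\<forall>i\<in>N. \<forall>v\<in>tnodes G - leaf_nodes G. eta_NA G v = i \<longrightarrow>
       (\<forall>P\<in>profiles N D. \<forall>P'\<in>profiles N D. \<forall>P''\<in>profiles N D.
          passes_through G P v \<and> passes_through G P' v \<and> passes_through G P'' v \<and>
          \<not> diverge G i (P i) (P' i) v \<and> diverge G i (P i) (P'' i) v \<longrightarrow>
          weakly_prefers (P i) (outcome G P' i) (outcome G P'' i)))"

text \<open>Naturals as nodes lose no generality, because the trees are finite.\<close>

definition SOSP_implementable ::
  "'i set \<Rightarrow> 'a set \<Rightarrow> 'a \<Rightarrow> ('i \<Rightarrow> 'a rel set) \<Rightarrow> (('i \<Rightarrow> 'a rel) \<Rightarrow> ('i \<Rightarrow> 'a)) \<Rightarrow> bool" where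
  "SOSP_implementable N A a0 D f \<longleftrightarrow>
     (\<exists>G :: (nat, 'i, 'a) mechanism.
        is_mechanism N A a0 D G \<and> SOSP N D G \<and> (\<forall>P\<in>profiles N D. f P = outcome G P))"

end

theory Submission
  imports Defs
begin

text \<open>At the first node where the profiles of a product subdomain split, the SOSP condition compares
  all assignments the moving agent obtains in the subdomain after different actions. Let the
  priorities agree on the agents at the top up to some point, and suppose that the remaining agents
  then own different objects. As there are more objects than agents, one of them, \<open>i\<close>, owns two
  objects \<open>a\<close> and \<open>c\<close>, while another one, \<open>j\<close>, owns \<open>b\<close>. Fix the preferences of the others, let those
  of \<open>i\<close> be \<open>bac\<close>, \<open>bca\<close> or \<open>abc\<close> and those of \<open>j\<close> be \<open>abc\<close>, \<open>acb\<close> or \<open>bac\<close>: neither \<open>i\<close> nor \<open>j\<close>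
  can be the first to split this subdomain. Hence all priorities coincide, and the rule is a serial
  dictatorship. Conversely, in a serial dictatorship it is simply best to reveal one's preference
  when one's turn comes.\<close>

section \<open>Strict orders\<close>

lemma strict_orders_asym:
  assumes "P \<in> strict_orders Y" "(x, y) \<in> P"
  shows "(y, x) \<notin> P"
  using assms unfolding strict_orders_def strict_linear_order_on_def irrefl_def trans_def by blast

lemma strict_orders_not_weakly_prefers:
  assumes "P \<in> strict_orders Y" "(x, y) \<in> P"
  shows "\<not> weakly_prefers P y x"
  using assms strict_orders_asym[OF assms(1)] unfolding weakly_prefers_def by blast

lemma best_eqI:
  assumes "P \<in> strict_orders Y" "x \<in> X" "\<And>y. y \<in> X \<Longrightarrow> y \<noteq> x \<Longrightarrow> (x, y) \<in> P"
  shows "best P X = x"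
  unfolding best_def
proof (rule the_equality)
  show "x \<in> X \<and> (\<forall>y\<in>X. y \<noteq> x \<longrightarrow> (x, y) \<in> P)" using assms(2,3) by blast
  fix x' assume x': "x' \<in> X \<and> (\<forall>y\<in>X. y \<noteq> x' \<longrightarrow> (x', y) \<in> P)"
  show "x' = x"
  proof (rule ccontr)
    assume "x' \<noteq> x"
    then have "(x, x') \<in> P" "(x', x) \<in> P" using assms(2,3) x' by auto
    then show False using strict_orders_asym[OF assms(1)] by blast
  qed
qed

lemma best_exists:
  assumes P: "P \<in> strict_orders Y" and "finite X" "X \<noteq> {}" "X \<subseteq> Y"
  shows "\<exists>x\<in>X. \<forall>y\<in>X. y \<noteq> x \<longrightarrow> (x, y) \<in> P"
  using assms(2-4)
proof (induction X rule: finite_ne_induct)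
  case (insert z F)
  then obtain x where x: "x \<in> F" "\<forall>y\<in>F. y \<noteq> x \<longrightarrow> (x, y) \<in> P" by auto
  have tr: "trans P" and "total_on Y P"
    using P unfolding strict_orders_def strict_linear_order_on_def by auto
  moreover have "x \<noteq> z" "x \<in> Y" "z \<in> Y" using x insert by auto
  ultimately consider "(x, z) \<in> P" | "(z, x) \<in> P" unfolding total_on_def by blast
  then show ?case
  proof cases
    case 1
    then show ?thesis using x by blast
  next
    case 2
    then have "(z, y) \<in> P" if "y \<in> F" for y
      using x(2) that transD[OF tr] by (cases "y = x") blast+
    then show ?thesis by blast
  qed
qed simp

lemma
  assumes P: "P \<in> strict_orders Y" and X: "finite X" "X \<noteq> {}" "X \<subseteq> Y"
  shows best_in: "best P X \<in> X"
    and best_above: "\<And>y. y \<in> X \<Longrightarrow> y \<noteq> best P X \<Longrightarrow> (best P X, y) \<in> P"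
proof -
  obtain x where x: "x \<in> X" "\<forall>y\<in>X. y \<noteq> x \<longrightarrow> (x, y) \<in> P"
    using best_exists[OF P X] by auto
  then have "best P X = x" using best_eqI[OF P] by blast
  then show "best P X \<in> X" "\<And>y. y \<in> X \<Longrightarrow> y \<noteq> best P X \<Longrightarrow> (best P X, y) \<in> P"
    using x by auto
qed

text \<open>Serves ownership: an object stays with its owner when other agents leave.\<close>

lemma best_subset:
  assumes P: "P \<in> strict_orders Y" and X: "finite X" "X \<subseteq> Y"
    and X': "X' \<subseteq> X" "best P X \<in> X'"
  shows "best P X' = best P X"
proof (rule best_eqI[OF P X'(2)])
  fix y assume "y \<in> X'" "y \<noteq> best P X"
  then show "(best P X, y) \<in> P" using best_above[OF P X(1) _ X(2)] X'(1) by blast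
qed

lemma finite_strict_orders: "finite X \<Longrightarrow> finite (strict_orders X)"
  unfolding strict_orders_def by (rule finite_subset[of _ "Pow (X \<times> X)"]) auto

section \<open>Orders with a prescribed list of top objects\<close>

text \<open>For distinct objects \<open>ts\<close>, this makes \<open>ts\<close> the top segment of
  \<open>P\<close>. The order below it stays open, since the assignments computed later depend only
  on the top objects.\<close>

definition ranks :: "'a set \<Rightarrow> 'a \<Rightarrow> 'a list \<Rightarrow> 'a rel \<Rightarrow> bool" where
  "ranks A a0 ts P \<longleftrightarrow> P \<in> all_acceptable A a0 \<and>
     (\<forall>m<length ts. \<forall>y\<in>insert a0 A - set (take (Suc m) ts). (ts ! m, y) \<in> P)"

text \<open>List \<open>ts\<close> first, then the other objects in any order, then
  \<open>a0\<close>, and compare positions in this list.\<close>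

lemma ranks_exists:
  assumes "finite A" "a0 \<notin> A" "distinct ts" "set ts \<subseteq> A"
  shows "\<exists>P. ranks A a0 ts P"
proof -
  obtain rs where rs: "set rs = A - set ts" "distinct rs"
    using finite_distinct_list assms(1) by (metis finite_Diff)
  define ys where "ys = ts @ rs @ [a0]"
  have ys: "distinct ys" "set ys = insert a0 A"
    unfolding ys_def using rs assms by auto
  define P where "P = {(ys ! p, ys ! q) | p q. p < q \<and> q < length ys}"
  have iff: "(ys ! p, ys ! q) \<in> P \<longleftrightarrow> p < q" if "p < length ys" "q < length ys" for p q
    unfolding P_def using that ys(1) by (auto simp: nth_eq_iff_index_eq)
  have sub: "P \<subseteq> insert a0 A \<times> insert a0 A"
    unfolding P_def ys(2)[symmetric] by auto
  have "trans P"
  proof (rule transI)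
    fix x y z assume xy: "(x, y) \<in> P" and yz: "(y, z) \<in> P"
    obtain p q where pq: "x = ys ! p" "y = ys ! q" "p < q" "q < length ys"
      using xy unfolding P_def by blast
    obtain q' r where qr: "y = ys ! q'" "z = ys ! r" "q' < r" "r < length ys"
      using yz unfolding P_def by blast
    have "q = q'" using pq qr ys(1) by (simp add: nth_eq_iff_index_eq)
    then show "(x, z) \<in> P" using pq qr iff by auto
  qed
  moreover have "irrefl P"
    unfolding irrefl_def P_def using ys(1) by (auto simp: nth_eq_iff_index_eq)
  moreover have "total_on (insert a0 A) P"
    unfolding total_on_def ys(2)[symmetric]
    by (metis iff in_set_conv_nth linorder_neqE_nat)
  ultimately have so: "P \<in> strict_orders (insert a0 A)"
    using sub unfolding strict_orders_def strict_linear_order_on_def by blast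
  have "(a, a0) \<in> P" if "a \<in> A" for a
  proof -
    \<comment> \<open>The outside option occupies the last position, so every object precedes
      it.\<close>
    have last: "a0 = ys ! (length ys - 1)" unfolding ys_def by (simp add: nth_append)
    have "a \<in> set ys" using that ys(2) by simp
    then obtain p where p: "p < length ys" "ys ! p = a" unfolding in_set_conv_nth by blast
    have "a \<noteq> a0" using that assms(2) by blast
    then have "p \<noteq> length ys - 1" using last p by auto
    then show ?thesis using iff[of p "length ys - 1"] p last by auto
  qed
  then have "P \<in> all_acceptable A a0" using so unfolding all_acceptable_def by blast
  moreover have "(ts ! m, y) \<in> P"
    if m: "m < length ts" and y: "y \<in> insert a0 A - set (take (Suc m) ts)" for m y
  proof -
    have "y \<in> set ys" using y ys(2) by simp
    then obtain q where q: "q < length ys" "ys ! q = y" unfolding in_set_conv_nth by blast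
    have "m < q"
    proof (rule ccontr)
      assume "\<not> m < q"
      then have "y = ts ! q" "q < Suc m" "q < length ts"
        using q m unfolding ys_def by (auto simp: nth_append)
      then show False using y by (metis DiffD2 in_set_conv_nth length_take min_less_iff_conj nth_take)
    qed
    moreover have "ts ! m = ys ! m" using m unfolding ys_def by (simp add: nth_append)
    moreover have "m < length ys" using \<open>m < q\<close> q by simp
    ultimately show ?thesis using iff[of m q] q by simp
  qed
  ultimately show ?thesis unfolding ranks_def by blast
qed

lemma ranks_best:
  assumes "ranks A a0 ts P" "m < length ts" "ts ! m \<in> X" "X \<subseteq> insert a0 A"
    "set (take m ts) \<inter> X = {}"
  shows "best P X = ts ! m"
proof (rule best_eqI)
  show "P \<in> strict_orders (insert a0 A)"
    using assms(1) unfolding ranks_def all_acceptable_def by blast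
  fix y assume "y \<in> X" "y \<noteq> ts ! m"
  then have "y \<in> insert a0 A - set (take (Suc m) ts)"
    using assms by (auto simp: take_Suc_conv_app_nth)
  then show "(ts ! m, y) \<in> P" using assms(1,2) unfolding ranks_def by blast
qed (use assms in auto)

lemma ranks_best_first:
  assumes "ranks A a0 (y # ts) P" "y \<in> X" "X \<subseteq> insert a0 A"
  shows "best P X = y"
  using ranks_best[OF assms(1), of 0 X] assms(2,3) by simp

lemma ranks_best_second:
  assumes "ranks A a0 (y # z # ts) P" "z \<in> X" "y \<notin> X" "X \<subseteq> insert a0 A"
  shows "best P X = z"
  using ranks_best[OF assms(1), of 1 X] assms(2-) by simp

lemma ranks_not_weakly_prefers:
  assumes "ranks A a0 ts P" "m < length ts" "y \<in> A - set (take (Suc m) ts)"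
  shows "\<not> weakly_prefers P y (ts ! m)"
  using assms strict_orders_not_weakly_prefers[of P "insert a0 A"]
  unfolding ranks_def all_acceptable_def by blast

lemma all_acceptable_nonempty:
  assumes "finite A" "a0 \<notin> A"
  shows "all_acceptable A a0 \<noteq> {}"
  using ranks_exists[OF assms, of "[]"] unfolding ranks_def by auto

lemma all_acceptable_best:
  assumes "P \<in> all_acceptable A a0" "finite B" "B \<noteq> {}" "B \<subseteq> A"
  shows "best P B \<in> B"
  using assms unfolding all_acceptable_def by (intro best_in[of P "insert a0 A"]) auto


section \<open>Mechanisms\<close>

lemma diverge_iff:
  "diverge G i q q' v \<longleftrightarrow> eta_NA G v = i \<and>
     (\<exists>w w'. w \<noteq> w' \<and> (v, w) \<in> tedges G \<and> (v, w') \<in> tedges G \<and>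
       q \<in> eta_EP G (v, w) \<and> q' \<in> eta_EP G (v, w'))"
proof -
  have "out_edges G v = Pair v ` {w. (v, w) \<in> tedges G}" unfolding out_edges_def by force
  then show ?thesis unfolding diverge_def by (simp add: bex_simps) blast
qed

lemma root_path_snoc:
  "root_path_to G (p @ [w]) v \<longleftrightarrow>
     v = w \<and> (if p = [] then w = troot G else root_path_to G p (last p) \<and> (last p, w) \<in> tedges G)"
  unfolding root_path_to_def by (auto simp: successively_append_iff)

lemma root_path_nth:
  assumes "root_path_to G p v" "Suc k < length p"
  shows "(p ! k, p ! Suc k) \<in> tedges G"
  using assms unfolding root_path_to_def by (auto simp: successively_conv_nth)

text \<open>\<open>root_path_to\<close> speaks only of edges; membership in \<open>tnodes\<close> is
  what gives access to the uniqueness of root paths in \<open>rooted_tree\<close>.\<close>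

lemma root_path_in_nodes:
  assumes "rooted_tree G"
  shows "root_path_to G p v \<Longrightarrow> v \<in> tnodes G"
proof (induction p arbitrary: v rule: rev_induct)
  case (snoc w p)
  then show ?case using assms unfolding rooted_tree_def
    by (auto simp: root_path_snoc split: if_splits)
qed (simp add: root_path_to_def)

lemma passes_through_step:
  assumes "passes_through G P v" "(v, w) \<in> tedges G" "P (eta_NA G v) \<in> eta_EP G (v, w)"
  shows "passes_through G P w"
proof -
  obtain p where p: "root_path_to G p v"
    "\<And>k. Suc k < length p \<Longrightarrow> P (eta_NA G (p ! k)) \<in> eta_EP G (p ! k, p ! Suc k)"
    using assms(1) unfolding passes_through_def by blast
  have ne: "p \<noteq> []" "last p = v" using p(1) unfolding root_path_to_def by auto
  have "root_path_to G (p @ [w]) w" using p(1) ne assms(2) by (simp add: root_path_snoc)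
  moreover have "P (eta_NA G ((p @ [w]) ! k)) \<in> eta_EP G ((p @ [w]) ! k, (p @ [w]) ! Suc k)"
    if "Suc k < length (p @ [w])" for k
  proof (cases "Suc k < length p")
    case True
    then show ?thesis using p(2)[of k] by (simp add: nth_append)
  next
    case False
    then have "k = length p - 1" "Suc k = length p" using that ne by auto
    then show ?thesis using assms(3) ne by (simp add: nth_append last_conv_nth)
  qed
  ultimately show ?thesis unfolding passes_through_def by blast
qed

lemma mechanism_labels:
  assumes "is_mechanism N A a0 D G" "v \<in> tnodes G - leaf_nodes G" "root_path_to G p v"
  shows "previous_move G p k \<Longrightarrow>
      (\<Union>e\<in>out_edges G v. eta_EP G e) = eta_EP G (p ! k, p ! Suc k)"
    and "\<nexists>k. previous_move G p k \<Longrightarrow> (\<Union>e\<in>out_edges G v. eta_EP G e) = D (eta_NA G v)"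
    and "eta_NA G v \<in> N"
  using assms unfolding is_mechanism_def by simp_all

lemma mechanism_edge_unique:
  assumes G: "is_mechanism N A a0 D G" and e: "e \<in> tedges G" "e' \<in> tedges G" "fst e = fst e'"
    and q: "q \<in> eta_EP G e" "q \<in> eta_EP G e'"
  shows "e = e'"
proof (rule ccontr)
  assume "e \<noteq> e'"
  then have "eta_EP G e \<inter> eta_EP G e' = {}" using G e unfolding is_mechanism_def by simp
  then show False using q by blast
qed

text \<open>Edges leaving a node have disjoint labels, so two paths followed by \<open>P\<close>
  agree as long as both last; neither can stop earlier, because a leaf has no outgoing edge. This
  makes the description in \<open>outcome\<close> meaningful.\<close>

lemma passes_through_leaf_unique:
  assumes G: "is_mechanism N A a0 D G"
    and l: "l \<in> leaf_nodes G" "passes_through G P l"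
    and l': "l' \<in> leaf_nodes G" "passes_through G P l'"
  shows "l = l'"
proof -
  obtain p where p: "root_path_to G p l"
    "\<And>k. Suc k < length p \<Longrightarrow> P (eta_NA G (p ! k)) \<in> eta_EP G (p ! k, p ! Suc k)"
    using l(2) unfolding passes_through_def by blast
  obtain p' where p': "root_path_to G p' l'"
    "\<And>k. Suc k < length p' \<Longrightarrow> P (eta_NA G (p' ! k)) \<in> eta_EP G (p' ! k, p' ! Suc k)"
    using l'(2) unfolding passes_through_def by blast
  have ends: "p \<noteq> []" "p ! 0 = troot G" "l = p ! (length p - 1)"
    "p' \<noteq> []" "p' ! 0 = troot G" "l' = p' ! (length p' - 1)"
    using p(1) p'(1) unfolding root_path_to_def by (auto simp: hd_conv_nth last_conv_nth)
  have agree: "k < length p \<Longrightarrow> k < length p' \<Longrightarrow> p ! k = p' ! k" for k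
  proof (induction k)
    case (Suc k)
    then have eq: "p ! k = p' ! k" by simp
    have "(p ! k, p ! Suc k) = (p' ! k, p' ! Suc k)"
    proof (rule mechanism_edge_unique[OF G])
      show "P (eta_NA G (p ! k)) \<in> eta_EP G (p ! k, p ! Suc k)" using p(2) Suc by blast
      show "P (eta_NA G (p ! k)) \<in> eta_EP G (p' ! k, p' ! Suc k)" unfolding eq using p'(2) Suc by blast
      show "(p ! k, p ! Suc k) \<in> tedges G" using root_path_nth[OF p(1)] Suc by blast
      show "(p' ! k, p' ! Suc k) \<in> tedges G" using root_path_nth[OF p'(1)] Suc by blast
    qed (use eq in simp)
    then show ?case by simp
  qed (use ends in simp)
  have leaf: "(v, w) \<notin> tedges G" if "v \<in> leaf_nodes G" for v w
    using that unfolding leaf_nodes_def out_edges_def by auto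
  have "\<not> length p < length p'"
  proof
    assume less: "length p < length p'"
    then have "(p' ! (length p - 1), p' ! Suc (length p - 1)) \<in> tedges G"
      using root_path_nth[OF p'(1), of "length p - 1"] ends(1) by simp
    then show False using leaf[OF l(1)] agree[of "length p - 1"] ends less by auto
  qed
  moreover have "\<not> length p' < length p"
  proof
    assume less: "length p' < length p"
    then have "(p ! (length p' - 1), p ! Suc (length p' - 1)) \<in> tedges G"
      using root_path_nth[OF p(1), of "length p' - 1"] ends(4) by simp
    then show False using leaf[OF l'(1)] agree[of "length p' - 1"] ends less by auto
  qed
  ultimately show ?thesis using agree[of "length p - 1"] ends by auto
qed

lemma outcome_eq:
  assumes "is_mechanism N A a0 D G" "l \<in> leaf_nodes G" "passes_through G P l"
  shows "outcome G P = eta_LA G l"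
proof -
  have "(THE l. l \<in> leaf_nodes G \<and> passes_through G P l) = l"
    using assms(2,3) passes_through_leaf_unique[OF assms(1)] by (intro the_equality) auto
  then show ?thesis unfolding outcome_def by simp
qed

text \<open>A profile never gets stuck: the labels leaving \<open>v\<close> cover either the whole
  domain of the mover or the label of the edge she took at her previous move, and that label
  contains her preference.\<close>

lemma passes_through_edge:
  assumes G: "is_mechanism N A a0 D G" and P: "P \<in> profiles N D"
    and v: "v \<in> tnodes G - leaf_nodes G" "passes_through G P v"
  shows "\<exists>w. (v, w) \<in> tedges G \<and> P (eta_NA G v) \<in> eta_EP G (v, w)"
proof -
  obtain p where p: "root_path_to G p v"
    "\<And>k. Suc k < length p \<Longrightarrow> P (eta_NA G (p ! k)) \<in> eta_EP G (p ! k, p ! Suc k)"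
    using v(2) unfolding passes_through_def by blast
  have "last p = v" using p(1) unfolding root_path_to_def by blast
  have "P (eta_NA G v) \<in> (\<Union>e\<in>out_edges G v. eta_EP G e)"
  proof (cases "\<exists>k. previous_move G p k")
    case True
    then obtain k where k: "previous_move G p k" by blast
    then have "(\<Union>e\<in>out_edges G v. eta_EP G e) = eta_EP G (p ! k, p ! Suc k)"
      using mechanism_labels(1)[OF G v(1) p(1)] by blast
    moreover have "Suc k < length p" "eta_NA G (p ! k) = eta_NA G v"
      using k \<open>last p = v\<close> unfolding previous_move_def by auto
    ultimately show ?thesis using p(2)[of k] by auto
  next
    case False
    then have "(\<Union>e\<in>out_edges G v. eta_EP G e) = D (eta_NA G v)"
      using mechanism_labels(2)[OF G v(1) p(1)] by blast
    moreover have "P (eta_NA G v) \<in> D (eta_NA G v)"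
      using P mechanism_labels(3)[OF G v(1) p(1)] unfolding profiles_def by (rule PiE_mem)
    ultimately show ?thesis by simp
  qed
  then show ?thesis unfolding out_edges_def by auto
qed

text \<open>\<open>i\<close> moves at the first node where the subdomain \<open>Q\<close> splits, and \<open>lab q\<close> is the successor of this
  node that her preference \<open>q\<close> leads to.\<close>

lemma SOSP_first_split:
  fixes G :: "('v, 'i, 'a) mechanism"
  assumes G: "is_mechanism N A a0 D G" and sosp: "SOSP N D G"
    and QD: "\<And>i. i \<in> N \<Longrightarrow> Q i \<subseteq> D i"
    and P1: "P1 \<in> profiles N Q" and P2: "P2 \<in> profiles N Q" "outcome G P1 \<noteq> outcome G P2"
  obtains i and lab :: "'a rel \<Rightarrow> 'v" and q q' where
    "i \<in> N" "q \<in> Q i" "q' \<in> Q i" "lab q \<noteq> lab q'"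
    "\<And>P P' P''. P \<in> profiles N Q \<Longrightarrow> P' \<in> profiles N Q \<Longrightarrow> P'' \<in> profiles N Q \<Longrightarrow>
       lab (P i) = lab (P' i) \<Longrightarrow> lab (P i) \<noteq> lab (P'' i) \<Longrightarrow>
       weakly_prefers (P i) (outcome G P' i) (outcome G P'' i)"
proof -
  have tree: "rooted_tree G" using G unfolding is_mechanism_def by blast
  have sub: "P \<in> profiles N D" if "P \<in> profiles N Q" for P
    using that QD unfolding profiles_def by blast
  \<comment> \<open>The node sought is a deepest one among those that all profiles of the subdomain
    pass through.\<close>
  define V where "V = {v \<in> tnodes G. \<forall>P\<in>profiles N Q. passes_through G P v}"
  define depth where "depth v = length (THE p. root_path_to G p v)" for v
  have depth: "depth v = length p" if "root_path_to G p v" for v p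
  proof -
    have "\<exists>!p. root_path_to G p v"
      using root_path_in_nodes[OF tree that] tree unfolding rooted_tree_def by blast
    then have "(THE p. root_path_to G p v) = p" using that by (rule the1_equality)
    then show ?thesis unfolding depth_def by simp
  qed
  have "root_path_to G [troot G] (troot G)" unfolding root_path_to_def by simp
  then have "passes_through G P (troot G)" for P
    unfolding passes_through_def by (intro exI[of _ "[troot G]"]) simp
  then have "troot G \<in> V" using tree unfolding V_def rooted_tree_def by blast
  moreover have "finite V" using tree unfolding V_def rooted_tree_def by simp
  ultimately have "Max (depth ` V) \<in> depth ` V" "\<And>w. w \<in> V \<Longrightarrow> depth w \<le> Max (depth ` V)"
    by (auto intro!: Max_in)
  then obtain v where v: "v \<in> V" "\<And>w. w \<in> V \<Longrightarrow> depth w \<le> depth v" by force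
  have pass: "passes_through G P v" if "P \<in> profiles N Q" for P using v that unfolding V_def by blast
  \<comment> \<open>At a leaf, \<open>P1\<close> and \<open>P2\<close> would have the same
    outcome.\<close>
  have "v \<notin> leaf_nodes G"
    using outcome_eq[OF G _ pass] P1 P2 by metis
  then have v': "v \<in> tnodes G - leaf_nodes G" using v unfolding V_def by blast
  define i where "i = eta_NA G v"
  have i: "i \<in> N" using G v' unfolding is_mechanism_def i_def by simp
  \<comment> \<open>The edge taken at \<open>v\<close> depends on the mover's preference alone. The
    value is arbitrary for an order that labels no edge leaving \<open>v\<close>.\<close>
  define lab where "lab q = (SOME w. (v, w) \<in> tedges G \<and> q \<in> eta_EP G (v, w))" for q
  have lab: "(v, lab (P i)) \<in> tedges G \<and> P i \<in> eta_EP G (v, lab (P i))" if "P \<in> profiles N Q" for P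
    using someI_ex[OF passes_through_edge[OF G sub[OF that] v' pass[OF that]]]
    unfolding lab_def i_def .
  have lab_eq: "lab (P i) = w"
    if "P \<in> profiles N Q" "(v, w) \<in> tedges G" "P i \<in> eta_EP G (v, w)" for P w
    using mechanism_edge_unique[OF G, of "(v, lab (P i))" "(v, w)" "P i"] lab[OF that(1)] that(2,3)
    by simp
  \<comment> \<open>Otherwise all profiles would continue to the same successor, which would be a
    deeper element of \<open>V\<close>.\<close>
  have "\<exists>P\<in>profiles N Q. lab (P i) \<noteq> lab (P1 i)"
  proof (rule ccontr)
    assume "\<not> ?thesis"
    then have same: "lab (P i) = lab (P1 i)" if "P \<in> profiles N Q" for P using that by blast
    let ?w = "lab (P1 i)"
    have "?w \<in> tnodes G" using lab[OF P1] tree unfolding rooted_tree_def by blast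
    moreover have "passes_through G P ?w" if "P \<in> profiles N Q" for P
      using passes_through_step[OF pass[OF that], of ?w] lab[OF that] same[OF that]
      unfolding i_def by simp
    ultimately have "?w \<in> V" unfolding V_def by blast
    moreover obtain p where p: "root_path_to G p v"
      using pass[OF P1] unfolding passes_through_def by blast
    have "p \<noteq> []" "last p = v" using p unfolding root_path_to_def by auto
    then have "root_path_to G (p @ [?w]) ?w" using lab[OF P1] p by (simp add: root_path_snoc)
    then have "depth ?w = Suc (depth v)" using depth p by simp
    ultimately show False using v(2) by fastforce
  qed
  then obtain P3 where P3: "P3 \<in> profiles N Q" "lab (P3 i) \<noteq> lab (P1 i)" by blast
  show thesis
  proof (rule that[of i "P3 i" "P1 i" lab, OF i _ _ P3(2)])
    show "P3 i \<in> Q i" "P1 i \<in> Q i" using P1 P3 i unfolding profiles_def by auto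
    fix P P' P''
    assume P: "P \<in> profiles N Q" "P' \<in> profiles N Q" "P'' \<in> profiles N Q"
      and eq: "lab (P i) = lab (P' i)" and neq: "lab (P i) \<noteq> lab (P'' i)"
    have "w = w'" if "(v, w) \<in> tedges G" "(v, w') \<in> tedges G"
      "P i \<in> eta_EP G (v, w)" "P' i \<in> eta_EP G (v, w')" for w w'
      using lab_eq[OF P(1) that(1,3)] lab_eq[OF P(2) that(2,4)] eq by simp
    then have "\<not> diverge G i (P i) (P' i) v" unfolding diverge_iff by blast
    moreover have "diverge G i (P i) (P'' i) v"
      using lab[OF P(1)] lab[OF P(3)] neq unfolding diverge_iff i_def by blast
    ultimately show "weakly_prefers (P i) (outcome G P' i) (outcome G P'' i)"
      using sosp[unfolded SOSP_def, rule_format, OF i v' i_def[symmetric], of P P' P'']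
        P pass sub by simp
  qed
qed


section \<open>Serial dictatorships are SOSP-implementable\<close>

text \<open>Domain and rule are general here. Non-empty \<open>D i\<close> ensures that the tree
  below ends only after all agents have moved; \<open>ext\<close> lets \<open>f P\<close> be an
  allocation, since those are extensional.\<close>

locale serial =
  fixes N :: "'i set" and A :: "'a set" and a0 :: 'a and D :: "'i \<Rightarrow> 'a rel set"
    and f :: "('i \<Rightarrow> 'a rel) \<Rightarrow> ('i \<Rightarrow> 'a)" and xs :: "'i list"
  assumes finite_A: "finite A" and a0: "a0 \<notin> A"
    and D: "\<And>i. i \<in> N \<Longrightarrow> D i \<subseteq> strict_orders (insert a0 A)" "\<And>i. i \<in> N \<Longrightarrow> D i \<noteq> {}"
    and xs: "distinct xs" "set xs = N"
    and choice: "\<And>P k. P \<in> profiles N D \<Longrightarrow> k < length xs \<Longrightarrow>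
      f P (xs ! k) = best (P (xs ! k)) (insert a0 (A - f P ` set (take k xs)))"
    and ext: "\<And>P. P \<in> profiles N D \<Longrightarrow> f P \<in> extensional N"
begin

lemma choice_in:
  assumes "P \<in> profiles N D" "k < length xs"
  shows "f P (xs ! k) \<in> insert a0 (A - f P ` set (take k xs))"
proof -
  have "xs ! k \<in> N" using assms(2) xs(2) by auto
  then have "P (xs ! k) \<in> strict_orders (insert a0 A)"
    using assms(1) D(1) unfolding profiles_def by blast
  then show ?thesis
    unfolding choice[OF assms] using finite_A by (intro best_in) auto
qed

text \<open>No object is assigned twice, because an object taken by one agent is missing from the
  choice sets of all later ones.\<close>

lemma allocation:
  assumes P: "P \<in> profiles N D"
  shows "f P \<in> allocations N A a0"
proof -
  have "f P i \<in> insert a0 A" if "i \<in> N" for i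
    using that choice_in[OF P] xs(2) by (metis DiffD1 in_set_conv_nth insert_iff)
  then have "f P \<in> N \<rightarrow>\<^sub>E insert a0 A" using ext[OF P] by (simp add: PiE_iff)
  moreover have "card {i \<in> N. f P i = a} \<le> 1" if a: "a \<in> A" for a
  proof -
    have later: "f P (xs ! k) \<noteq> a" if "f P (xs ! m) = a" "m < k" "k < length xs" for k m
    proof -
      have "xs ! m \<in> set (take k xs)" using that by (auto simp: in_set_conv_nth)
      then show ?thesis using choice_in[OF P that(3)] that(1) a a0 by auto
    qed
    have "i = j" if ij: "i \<in> N" "j \<in> N" "f P i = a" "f P j = a" for i j
    proof -
      obtain m k where "m < length xs" "xs ! m = i" "k < length xs" "xs ! k = j"
        using ij xs(2) by (metis in_set_conv_nth)
      then show ?thesis using later[of m k] later[of k m] ij by (metis linorder_neqE_nat)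
    qed
    then have "\<forall>i\<in>{i \<in> N. f P i = a}. \<forall>j\<in>{i \<in> N. f P i = a}. i = j" by blast
    moreover have "finite {i \<in> N. f P i = a}" using xs(2) by auto
    ultimately show ?thesis using card_le_Suc0_iff_eq[of "{i \<in> N. f P i = a}"] by simp
  qed
  ultimately show ?thesis unfolding allocations_def by blast
qed

text \<open>The agents reveal their preferences one after the other in the order \<open>xs\<close>; a node is the
  list of the preferences revealed so far.\<close>

definition nodes :: "'a rel list set" where
  "nodes = {l. length l \<le> length xs \<and> (\<forall>k<length l. l ! k \<in> D (xs ! k))}"

text \<open>\<open>SOSP_implementable\<close> prescribes natural numbers as nodes; an injection
  exists because \<open>nodes\<close> is finite.\<close>

definition enc :: "'a rel list \<Rightarrow> nat" where
  "enc = (SOME e. inj_on e nodes)"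

definition dec :: "nat \<Rightarrow> 'a rel list" where
  "dec = inv_into nodes enc"

text \<open>Recovers a profile from a complete list of revealed preferences. It is unique because
  profiles are extensional and \<open>xs\<close> enumerates \<open>N\<close>.\<close>

definition prof :: "'a rel list \<Rightarrow> ('i \<Rightarrow> 'a rel)" where
  "prof l = (SOME P. P \<in> profiles N D \<and> map P xs = l)"

text \<open>Each edge appends one order and carries it as a singleton label, so any two different
  preferences of the mover diverge at her node.\<close>

definition tree :: "(nat, 'i, 'a) mechanism" where
  "tree = \<lparr>tnodes = enc ` nodes,
     tedges = {(enc l, enc (l @ [q])) | l q. l @ [q] \<in> nodes},
     troot = enc [],
     eta_LA = (\<lambda>v. f (prof (dec v))),
     eta_NA = (\<lambda>v. xs ! length (dec v)),
     eta_EP = (\<lambda>e. {last (dec (snd e))})\<rparr>"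

lemma finite_nodes: "finite nodes"
proof (rule finite_subset)
  show "nodes \<subseteq> {l. set l \<subseteq> strict_orders (insert a0 A) \<and> length l \<le> length xs}"
  proof (clarsimp simp: nodes_def)
    fix l q
    assume l: "length l \<le> length xs" "\<forall>k<length l. l ! k \<in> D (xs ! k)" "q \<in> set l"
    then obtain k where "k < length l" "q = l ! k" by (auto simp: in_set_conv_nth)
    moreover from this have "xs ! k \<in> N" using l(1) xs(2) by auto
    ultimately show "q \<in> strict_orders (insert a0 A)" using l(2) D(1) by blast
  qed
  show "finite {l. set l \<subseteq> strict_orders (insert a0 A) \<and> length l \<le> length xs}"
    using finite_A by (intro finite_lists_length_le finite_strict_orders) simp
qed

lemma inj_enc: "inj_on enc nodes"
proof -
  have "\<exists>e :: 'a rel list \<Rightarrow> nat. inj_on e nodes"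
    using finite_imp_inj_to_nat_seg[OF finite_nodes] by blast
  then show ?thesis unfolding enc_def by (rule someI_ex)
qed

lemma dec_enc [simp]: "l \<in> nodes \<Longrightarrow> dec (enc l) = l"
  unfolding dec_def using inj_enc by (rule inv_into_f_f)

lemma enc_eq_iff: "l \<in> nodes \<Longrightarrow> l' \<in> nodes \<Longrightarrow> enc l = enc l' \<longleftrightarrow> l = l'"
  using inj_enc by (auto simp: inj_on_def)

lemma Nil_in_nodes: "[] \<in> nodes"
  unfolding nodes_def by simp

lemma snoc_in_nodes:
  "l @ [q] \<in> nodes \<longleftrightarrow> l \<in> nodes \<and> length l < length xs \<and> q \<in> D (xs ! length l)"
  unfolding nodes_def by (auto simp: nth_append less_Suc_eq)

lemma take_in_nodes: "l \<in> nodes \<Longrightarrow> take k l \<in> nodes"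
  unfolding nodes_def by auto

lemma prefix_in_nodes:
  assumes "P \<in> profiles N D"
  shows "map P (take k xs) \<in> nodes"
proof -
  have "P (xs ! m) \<in> D (xs ! m)" if "m < length xs" for m
    using that assms xs(2) unfolding profiles_def by auto
  then show ?thesis unfolding nodes_def by auto
qed

lemma prof_eq:
  assumes P: "P \<in> profiles N D"
  shows "prof (map P xs) = P"
  unfolding prof_def
proof (rule some_equality)
  fix P' assume P': "P' \<in> profiles N D \<and> map P' xs = map P xs"
  show "P' = P"
  proof (rule PiE_ext)
    show "P' \<in> (\<Pi>\<^sub>E i\<in>N. D i)" "P \<in> (\<Pi>\<^sub>E i\<in>N. D i)" using P P' unfolding profiles_def by auto
    show "P' i = P i" if "i \<in> N" for i using that P' xs(2) by auto
  qed
qed (use P in simp)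

lemma prof_in_profiles:
  assumes l: "l \<in> nodes" "length l = length xs"
  shows "prof l \<in> profiles N D"
proof -
  define P where "P = (\<lambda>i\<in>N. the (map_of (zip xs l) i))"
  have P: "P (xs ! k) = l ! k" if "k < length xs" for k
    using that l(2) xs map_of_zip_nth[of xs l k] unfolding P_def by auto
  have "P i \<in> D i" if "i \<in> N" for i
    using that xs(2) P l unfolding nodes_def by (metis (mono_tags, lifting) in_set_conv_nth mem_Collect_eq)
  then have "P \<in> profiles N D" unfolding profiles_def P_def by auto
  moreover have "map P xs = l" using P l(2) by (auto intro: nth_equalityI)
  ultimately show ?thesis using prof_eq[of P] by auto
qed

lemma tree_edge_iff:
  assumes "l \<in> nodes"
  shows "(u, enc l) \<in> tedges tree \<longleftrightarrow> (\<exists>l' q. l = l' @ [q] \<and> u = enc l')"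
  using assms enc_eq_iff[OF assms] unfolding tree_def by auto

lemma tree_out_edges:
  assumes "l \<in> nodes"
  shows "out_edges tree (enc l) = {(enc l, enc (l @ [q])) | q. l @ [q] \<in> nodes}"
  unfolding out_edges_def tree_def by (auto simp: snoc_in_nodes enc_eq_iff[OF _ assms])

lemma tree_leaf_iff:
  assumes "l \<in> nodes"
  shows "enc l \<in> leaf_nodes tree \<longleftrightarrow> length l = length xs"
proof -
  have "D (xs ! length l) \<noteq> {}" if "length l < length xs" using that D(2) xs(2) by auto
  moreover have "length l \<le> length xs" using assms unfolding nodes_def by blast
  moreover have "enc l \<in> tnodes tree" using assms unfolding tree_def by simp
  ultimately show ?thesis
    unfolding leaf_nodes_def using tree_out_edges[OF assms] snoc_in_nodes[of l] assms
    by fastforce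
qed

text \<open>The only edge into a non-empty list comes from the list without its last entry, so the
  root path runs through all prefixes, starting with the empty one.\<close>

lemma tree_root_path_iff:
  "l \<in> nodes \<Longrightarrow> root_path_to tree p (enc l) \<longleftrightarrow>
     p = map (\<lambda>m. enc (take m l)) [0..<Suc (length l)]"
proof (induction l arbitrary: p rule: rev_induct)
  case Nil
  have "(u, enc []) \<notin> tedges tree" for u using tree_edge_iff[OF Nil] by simp
  moreover have "troot tree = enc []" unfolding tree_def by simp
  ultimately show ?case
    by (cases p rule: rev_cases) (auto simp: root_path_snoc, auto simp: root_path_to_def)
next
  case (snoc q l)
  have l: "l \<in> nodes" using snoc.prems snoc_in_nodes by blast
  have path: "map (\<lambda>m. enc (take m (l @ [q]))) [0..<Suc (length (l @ [q]))] =
      map (\<lambda>m. enc (take m l)) [0..<Suc (length l)] @ [enc (l @ [q])]"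
    by simp
  have root: "enc (l @ [q]) \<noteq> troot tree"
    using enc_eq_iff[OF snoc.prems Nil_in_nodes] unfolding tree_def by simp
  have edge: "(u, enc (l @ [q])) \<in> tedges tree \<longleftrightarrow> u = enc l" for u
    using tree_edge_iff[OF snoc.prems] by auto
  show ?case
  proof (cases p rule: rev_cases)
    case Nil
    then show ?thesis unfolding root_path_to_def by simp
  next
    case p: (snoc p' w)
    have "root_path_to tree p (enc (l @ [q])) \<longleftrightarrow>
        w = enc (l @ [q]) \<and> p' \<noteq> [] \<and> last p' = enc l \<and> root_path_to tree p' (enc l)"
      unfolding p root_path_snoc using root edge by auto
    also have "\<dots> \<longleftrightarrow> w = enc (l @ [q]) \<and> root_path_to tree p' (enc l)"
      unfolding root_path_to_def by auto
    also have "\<dots> \<longleftrightarrow> p = map (\<lambda>m. enc (take m (l @ [q]))) [0..<Suc (length (l @ [q]))]"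
      unfolding path p snoc.IH[OF l] by auto
    finally show ?thesis .
  qed
qed

lemma eta_EP_tree: "l @ [q] \<in> nodes \<Longrightarrow> eta_EP tree (u, enc (l @ [q])) = {q}"
  unfolding tree_def by simp

lemma eta_NA_tree: "l \<in> nodes \<Longrightarrow> eta_NA tree (enc l) = xs ! length l"
  unfolding tree_def by simp

lemma passes_through_tree_iff:
  assumes l: "l \<in> nodes"
  shows "passes_through tree P (enc l) \<longleftrightarrow> l = map P (take (length l) xs)"
proof -
  let ?p = "map (\<lambda>m. enc (take m l)) [0..<Suc (length l)]"
  have len: "length l \<le> length xs" using l unfolding nodes_def by blast
  have nth: "?p ! m = enc (take m l)" if "m \<le> length l" for m
    using that by (simp del: upt_Suc)
  have "P (eta_NA tree (?p ! m)) \<in> eta_EP tree (?p ! m, ?p ! Suc m) \<longleftrightarrow> P (xs ! m) = l ! m"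
    if m: "m < length l" for m
  proof -
    have t: "take (Suc m) l = take m l @ [l ! m]" using m by (rule take_Suc_conv_app_nth)
    have "eta_EP tree (?p ! m, ?p ! Suc m) = {l ! m}"
      using nth[of "Suc m"] m eta_EP_tree[of "take m l" "l ! m"] take_in_nodes[OF l, of "Suc m"]
      unfolding t by (simp del: upt_Suc)
    moreover have "eta_NA tree (?p ! m) = xs ! m"
      using nth[of m] m eta_NA_tree[OF take_in_nodes[OF l, of m]] by (simp del: upt_Suc)
    ultimately show ?thesis by simp
  qed
  then have "passes_through tree P (enc l) \<longleftrightarrow> (\<forall>m<length l. P (xs ! m) = l ! m)"
    unfolding passes_through_def tree_root_path_iff[OF l] by (simp del: upt_Suc)
  also have "\<dots> \<longleftrightarrow> l = map P (take (length l) xs)"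
    using len by (auto simp: list_eq_iff_nth_eq)
  finally show ?thesis .
qed

text \<open>As \<open>xs\<close> is distinct, no agent moves twice on a path. Hence only the case
  without a previous move arises in the labelling condition, and there the mover may reveal any
  element of her domain.\<close>

lemma tree_is_mechanism: "is_mechanism N A a0 D tree"
proof -
  have nodes_eq: "tnodes tree = enc ` nodes" unfolding tree_def by simp
  have edgeE: "\<exists>l q. e = (enc l, enc (l @ [q])) \<and> l @ [q] \<in> nodes" if "e \<in> tedges tree" for e
    using that unfolding tree_def by auto
  have rooted: "rooted_tree tree"
    unfolding rooted_tree_def
  proof (intro conjI ballI)
    show "finite (tnodes tree)" using finite_nodes nodes_eq by simp
    show "troot tree \<in> tnodes tree" using Nil_in_nodes unfolding tree_def by simp
    show "tedges tree \<subseteq> tnodes tree \<times> tnodes tree"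
    proof
      fix e assume "e \<in> tedges tree"
      then obtain l q where "e = (enc l, enc (l @ [q]))" "l @ [q] \<in> nodes" using edgeE by blast
      moreover from this have "l \<in> nodes" using snoc_in_nodes by blast
      ultimately show "e \<in> tnodes tree \<times> tnodes tree" unfolding nodes_eq by simp
    qed
    show "\<exists>!p. root_path_to tree p v" if "v \<in> tnodes tree" for v
      using that nodes_eq tree_root_path_iff by auto
  qed
  have LA: "eta_LA tree v \<in> allocations N A a0" if leaf: "v \<in> leaf_nodes tree" for v
  proof -
    obtain l where l: "l \<in> nodes" "v = enc l"
      using leaf nodes_eq unfolding leaf_nodes_def by blast
    then have "length l = length xs" using tree_leaf_iff leaf by blast
    then have "f (prof l) \<in> allocations N A a0" using allocation prof_in_profiles l by blast
    then show ?thesis using l unfolding tree_def by simp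
  qed
  have NA: "eta_NA tree v \<in> N" and prev: "\<not> previous_move tree p k"
    and labels:
    "(\<Union>e\<in>out_edges tree v. eta_EP tree e) = D (eta_NA tree v)"
    if v: "v \<in> tnodes tree - leaf_nodes tree" and p: "root_path_to tree p v" for v p k
  proof -
    obtain l where l: "l \<in> nodes" "v = enc l" using v nodes_eq by blast
    then have "length l \<noteq> length xs" using tree_leaf_iff v by blast
    moreover have "length l \<le> length xs" using l unfolding nodes_def by blast
    ultimately have len: "length l < length xs" by simp
    then show "eta_NA tree v \<in> N" using eta_NA_tree l xs(2) by auto
    have p: "p = map (\<lambda>m. enc (take m l)) [0..<Suc (length l)]"
      using p tree_root_path_iff l by blast
    show "\<not> previous_move tree p k"
    proof
      assume k: "previous_move tree p k"
      have "k < length l" using k p unfolding previous_move_def by simp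
      then have "eta_NA tree (p ! k) = xs ! k"
        using p eta_NA_tree[OF take_in_nodes[OF l(1), of k]] by (simp del: upt_Suc)
      moreover have "eta_NA tree (last p) = xs ! length l"
        using p eta_NA_tree[OF l(1)] by simp
      ultimately show False
        using k \<open>k < length l\<close> len xs(1) unfolding previous_move_def
        by (simp add: nth_eq_iff_index_eq)
    qed
    have "(\<Union>e\<in>out_edges tree v. eta_EP tree e) = {q. l @ [q] \<in> nodes}"
      unfolding l(2) tree_out_edges[OF l(1)] using eta_EP_tree by auto
    also have "\<dots> = D (eta_NA tree v)" using snoc_in_nodes[of l] l len eta_NA_tree by auto
    finally show "(\<Union>e\<in>out_edges tree v. eta_EP tree e) = D (eta_NA tree v)" .
  qed
  have EP: "eta_EP tree e \<subseteq> strict_orders (insert a0 A) \<and> eta_EP tree e \<noteq> {}"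
    if e: "e \<in> tedges tree" for e
  proof -
    obtain l q where lq: "e = (enc l, enc (l @ [q]))" "l @ [q] \<in> nodes" using edgeE[OF e] by blast
    then have "q \<in> D (xs ! length l)" "length l < length xs" using snoc_in_nodes by auto
    then have "q \<in> strict_orders (insert a0 A)" using D(1)[of "xs ! length l"] xs(2) by auto
    then show ?thesis using lq eta_EP_tree by simp
  qed
  have disj: "eta_EP tree e \<inter> eta_EP tree e' = {}"
    if e: "e \<in> tedges tree" "e' \<in> tedges tree" "e \<noteq> e'" "fst e = fst e'" for e e'
  proof -
    obtain l q where lq: "e = (enc l, enc (l @ [q]))" "l @ [q] \<in> nodes" using edgeE[OF e(1)] by blast
    obtain l' q' where lq': "e' = (enc l', enc (l' @ [q']))" "l' @ [q'] \<in> nodes"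
      using edgeE[OF e(2)] by blast
    have "l = l'" using lq lq' e(3,4) enc_eq_iff snoc_in_nodes by auto
    then show ?thesis using lq lq' e(3,4) eta_EP_tree by auto
  qed
  show ?thesis
    unfolding is_mechanism_def
  proof (intro conjI ballI allI impI)
    show "eta_NA tree v \<in> N" if v: "v \<in> tnodes tree - leaf_nodes tree" for v
    proof -
      obtain l where "l \<in> nodes" "v = enc l" using v nodes_eq by blast
      then show ?thesis using NA[OF v] tree_root_path_iff by simp
    qed
    show "eta_EP tree e \<inter> eta_EP tree e' = {}"
      if "e \<in> tedges tree" "e' \<in> tedges tree" "e \<noteq> e' \<and> fst e = fst e'" for e e'
      using disj[of e e'] that by simp
    show "(\<Union>e\<in>out_edges tree v. eta_EP tree e) = eta_EP tree (p ! k, p ! Suc k)"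
      if "v \<in> tnodes tree - leaf_nodes tree" "root_path_to tree p v" "previous_move tree p k" for v p k
      using prev[OF that(1,2)] that(3) by simp
  qed (use rooted LA EP labels in simp_all)
qed

lemma tree_outcome:
  assumes P: "P \<in> profiles N D"
  shows "outcome tree P = f P"
proof -
  have l: "map P xs \<in> nodes" using prefix_in_nodes[OF P, of "length xs"] by simp
  have "outcome tree P = eta_LA tree (enc (map P xs))"
    using outcome_eq[OF tree_is_mechanism] tree_leaf_iff[OF l] passes_through_tree_iff[OF l] by simp
  also have "\<dots> = f P" using l prof_eq[OF P] unfolding tree_def by simp
  finally show ?thesis .
qed

text \<open>By strong induction: a choice depends on the agent's own preference and on the objects
  taken before her turn.\<close>

lemma same_prefix_same_choices:
  assumes P: "P \<in> profiles N D" and P': "P' \<in> profiles N D"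
    and eq: "map P (take k xs) = map P' (take k xs)"
  shows "m < k \<Longrightarrow> m < length xs \<Longrightarrow> f P (xs ! m) = f P' (xs ! m)"
proof (induction m rule: less_induct)
  case (less m)
  have "f P ` set (take m xs) = f P' ` set (take m xs)"
  proof (rule image_cong)
    fix x assume "x \<in> set (take m xs)"
    then obtain j where "j < m" "x = xs ! j" "j < length xs" by (auto simp: in_set_conv_nth)
    then show "f P x = f P' x" using less by simp
  qed simp
  moreover have "xs ! m \<in> set (take k xs)" using less.prems by (auto simp: in_set_conv_nth)
  then have "P (xs ! m) = P' (xs ! m)" using eq by auto
  ultimately show ?case using choice[OF P] choice[OF P'] less.prems by simp
qed

text \<open>When her turn comes, the mover's choice set is already fixed. With her true preference
  she obtains its best element, and with any other preference she still obtains some element of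
  it.\<close>

lemma tree_SOSP: "SOSP N D tree"
  unfolding SOSP_def
proof (intro ballI impI, elim conjE)
  fix i v P P' P''
  assume v: "v \<in> tnodes tree - leaf_nodes tree" and i: "eta_NA tree v = i"
    and P: "P \<in> profiles N D" "P' \<in> profiles N D" "P'' \<in> profiles N D"
    and pass: "passes_through tree P v" "passes_through tree P' v" "passes_through tree P'' v"
    and ndiv: "\<not> diverge tree i (P i) (P' i) v"
  obtain l where l: "l \<in> nodes" "v = enc l" using v unfolding tree_def by auto
  have pre: "l = map P (take (length l) xs)" "l = map P' (take (length l) xs)"
    "l = map P'' (take (length l) xs)"
    using pass passes_through_tree_iff[OF l(1)] l(2) by blast+
  have "length l \<noteq> length xs" using tree_leaf_iff v l by blast
  moreover have "length l \<le> length xs" using l unfolding nodes_def by blast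
  ultimately have len: "length l < length xs" by simp
  have i: "i = xs ! length l" using i eta_NA_tree l by simp
  have "i \<in> N" using i len xs(2) by auto
  then have Di: "P i \<in> D i" "P' i \<in> D i" using P unfolding profiles_def by auto
  \<comment> \<open>With singleton labels, not diverging at her own node means equality.\<close>
  have "P i = P' i"
  proof (rule ccontr)
    assume ne: "P i \<noteq> P' i"
    have n: "l @ [P i] \<in> nodes" "l @ [P' i] \<in> nodes" using snoc_in_nodes l len Di i by auto
    then have "(enc l, enc (l @ [P i])) \<noteq> (enc l, enc (l @ [P' i]))"
      using enc_eq_iff ne by simp
    moreover have "(enc l, enc (l @ [P i])) \<in> out_edges tree v"
      "(enc l, enc (l @ [P' i])) \<in> out_edges tree v"
      using tree_out_edges l n by auto
    ultimately have "diverge tree i (P i) (P' i) v"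
      using eta_EP_tree n eta_NA_tree[OF l(1)] i l(2) unfolding diverge_def by blast
    then show False using ndiv by blast
  qed
  define X where "X = insert a0 (A - f P' ` set (take (length l) xs))"
  have X: "finite X" "X \<noteq> {}" "X \<subseteq> insert a0 A" unfolding X_def using finite_A by auto
  \<comment> \<open>Both profiles reach \<open>v\<close>, so they agree on the earlier movers and
    leave the same choice set \<open>X\<close>.\<close>
  have "f P' x = f P'' x" if "x \<in> set (take (length l) xs)" for x
  proof -
    obtain m where "m < length l" "x = xs ! m" "m < length xs"
      using \<open>x \<in> set (take (length l) xs)\<close> by (auto simp: in_set_conv_nth)
    then show ?thesis using same_prefix_same_choices[OF P(2,3), of "length l" m] pre by simp
  qed
  then have "f P'' ` set (take (length l) xs) = f P' ` set (take (length l) xs)"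
    by (intro image_cong) auto
  then have "f P'' i \<in> X"
    using choice_in[OF P(3) len] i unfolding X_def by simp
  moreover have "f P' i = best (P i) X"
    using choice[OF P(2) len] i \<open>P i = P' i\<close> unfolding X_def by simp
  moreover have "P i \<in> strict_orders (insert a0 A)" using D(1)[OF \<open>i \<in> N\<close>] Di by blast
  ultimately have "weakly_prefers (P i) (f P' i) (f P'' i)"
    using best_above[OF _ X] unfolding weakly_prefers_def by metis
  then show "weakly_prefers (P i) (outcome tree P' i) (outcome tree P'' i)"
    using tree_outcome P by simp
qed

lemma implementable: "SOSP_implementable N A a0 D f"
  unfolding SOSP_implementable_def using tree_is_mechanism tree_SOSP tree_outcome by metis

end


section \<open>Top trading cycles\<close>

lemma ttc_graph_iff:
  assumes "P x \<in> all_acceptable A a0" "B \<subseteq> A" "B \<noteq> {}"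
  shows "(x, y) \<in> ttc_graph prio a0 P M B \<longleftrightarrow> x \<in> M \<and> y = best (prio (best (P x) B)) M"
proof -
  have "{a \<in> B. (a, a0) \<in> P x} = B" using assms unfolding all_acceptable_def by blast
  then show ?thesis using assms(3) unfolding ttc_graph_def by (simp only: Let_def) auto
qed

locale market =
  fixes N :: "'i set" and A :: "'a set" and a0 :: 'a and prio :: "'a \<Rightarrow> 'i rel"
  assumes finite_N: "finite N" and finite_A: "finite A" and a0: "a0 \<notin> A"
    and more_objects: "card N < card A"
    and prio: "\<And>a. a \<in> A \<Longrightarrow> prio a \<in> strict_orders N"
begin

abbreviation "prefs \<equiv> all_acceptable A a0"
abbreviation "profs \<equiv> profiles N (\<lambda>_. prefs)"
abbreviation "f \<equiv> FPTTC N A a0 prio"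
abbreviation "remaining \<equiv> ttc_remaining N A a0 prio"

text \<open>The step graph as a function. As all objects are acceptable on \<open>prefs\<close>, it
  gives the unique successor of a remaining agent while objects remain.\<close>

definition target :: "('i \<Rightarrow> 'a rel) \<Rightarrow> 'i set \<Rightarrow> 'a set \<Rightarrow> 'i \<Rightarrow> 'i" where
  "target P M B x = best (prio (best (P x) B)) M"

lemma profsD: "P \<in> profs \<Longrightarrow> x \<in> N \<Longrightarrow> P x \<in> prefs"
  unfolding profiles_def by blast

lemma graph_iff:
  assumes "P \<in> profs" "M \<subseteq> N" "B \<subseteq> A" "B \<noteq> {}"
  shows "(x, y) \<in> ttc_graph prio a0 P M B \<longleftrightarrow> x \<in> M \<and> y = target P M B x"
proof (cases "x \<in> M")
  case True
  then show ?thesis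
    using ttc_graph_iff[of P x A a0 B y prio M] profsD[OF assms(1), of x] assms
    unfolding target_def by blast
qed (simp add: ttc_graph_def)

lemma cyclic_selfI:
  assumes "P \<in> profs" "M \<subseteq> N" "B \<subseteq> A" "B \<noteq> {}" "x \<in> M" "target P M B x = x"
  shows "x \<in> ttc_cyclic prio a0 P M B"
proof -
  have "(x, x) \<in> ttc_graph prio a0 P M B" using graph_iff assms by auto
  then show ?thesis using assms(5) unfolding ttc_cyclic_def by blast
qed

lemma cyclic_pairI:
  assumes "P \<in> profs" "M \<subseteq> N" "B \<subseteq> A" "B \<noteq> {}"
    "x \<in> M" "y \<in> M" "target P M B x = y" "target P M B y = x"
  shows "x \<in> ttc_cyclic prio a0 P M B"
proof -
  have "(x, y) \<in> ttc_graph prio a0 P M B" "(y, x) \<in> ttc_graph prio a0 P M B"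
    using graph_iff assms by auto
  then show ?thesis using assms(5) unfolding ttc_cyclic_def by auto
qed

text \<open>Every walk reaches the self-loop at \<open>y\<close> within two steps and then stays
  there, so no other agent can return to herself.\<close>

lemma cyclic_singleton:
  assumes st: "P \<in> profs" "M \<subseteq> N" "B \<subseteq> A" "B \<noteq> {}" and "y \<in> M"
    and y: "target P M B y = y"
    and short: "\<And>x. x \<in> M \<Longrightarrow> target P M B x = y \<or> target P M B (target P M B x) = y"
  shows "ttc_cyclic prio a0 P M B = {y}"
proof -
  have "z = target P M B x \<or> z = y" if "(x, z) \<in> (ttc_graph prio a0 P M B)\<^sup>+" "x \<in> M" for x z
    using that(1)
  proof (induction rule: trancl_induct)
    case (base z)
    then show ?case using graph_iff[OF st] by blast
  next
    case (step z w)
    then show ?case using graph_iff[OF st] short[OF that(2)] y by metis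
  qed
  then have "x = y" if "x \<in> ttc_cyclic prio a0 P M B" for x
    using that short[of x] unfolding ttc_cyclic_def by fastforce
  then show ?thesis using cyclic_selfI[OF st \<open>y \<in> M\<close> y] by blast
qed

lemma remaining_antimono: "s \<le> t \<Longrightarrow> fst (remaining P t) \<subseteq> fst (remaining P s)"
proof (induction t rule: dec_induct)
  case (step t)
  then show ?case by (auto simp: Let_def split: prod.split)
qed simp

text \<open>Assigned agents are removed and never come back; hence the step chosen by
  \<open>THE\<close> in \<open>FPTTC\<close> is well defined.\<close>

lemma assigned_at_unique:
  assumes "i \<in> ttc_assigned_at N A a0 prio P s" "i \<in> ttc_assigned_at N A a0 prio P t"
  shows "s = t"
proof -
  have "i \<notin> ttc_assigned_at N A a0 prio P t"
    if "i \<in> ttc_assigned_at N A a0 prio P s" "s < t" for s t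
  proof -
    have "i \<notin> fst (remaining P (Suc s))"
      using that(1) unfolding ttc_assigned_at_def by (auto simp: Let_def split: prod.splits)
    then have "i \<notin> fst (remaining P t)" using remaining_antimono[of "Suc s" t P] that(2) by auto
    then show ?thesis
      unfolding ttc_assigned_at_def ttc_cyclic_def by (auto simp: Let_def split: prod.splits)
  qed
  then show ?thesis using assms by (metis linorder_neqE_nat)
qed

lemma FPTTC_eq:
  assumes "i \<in> N" "remaining P s = (M, B)" "i \<in> ttc_cyclic prio a0 P M B"
  shows "f P i = best (P i) (insert a0 B)"
proof -
  have s: "i \<in> ttc_assigned_at N A a0 prio P s"
    using assms unfolding ttc_assigned_at_def by simp
  then have "(THE t. i \<in> ttc_assigned_at N A a0 prio P t) = s"
    using assigned_at_unique by blast
  then show ?thesis using s assms(1,2) unfolding FPTTC_def by (auto simp: Let_def)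
qed

lemma remaining_Suc:
  assumes "remaining P s = (M, B)" "ttc_cyclic prio a0 P M B = {y}"
  shows "remaining P (Suc s) = (M - {y}, B - {best (P y) (insert a0 B)})"
  using assms by simp

section \<open>Common top segments of the priorities\<close>

text \<open>All priorities start with \<open>xs\<close>. This is expressed through maximal remaining
  agents, as owners are in the step graph, and for partial lists, so that the list can grow agent by
  agent.\<close>

definition dictators :: "'i list \<Rightarrow> bool" where
  "dictators xs \<longleftrightarrow> distinct xs \<and> set xs \<subseteq> N \<and>
     (\<forall>a\<in>A. \<forall>m<length xs. best (prio a) (N - set (take m xs)) = xs ! m)"

text \<open>At most \<open>card N\<close> objects can have been taken, fewer than there are. A
  non-empty set of objects is what \<open>graph_iff\<close> requires.\<close>

lemma dictators_objects_left:
  assumes "dictators xs" "m \<le> length xs" "m < length xs \<or> set xs \<noteq> N"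
  shows "A - g ` set (take m xs) \<noteq> {}"
proof -
  have "card (g ` set (take m xs)) \<le> card (set (take m xs))" by (rule card_image_le) simp
  also have "\<dots> \<le> card N"
    using assms(1) finite_N unfolding dictators_def
    by (meson card_mono order_trans set_take_subset)
  finally have "card (g ` set (take m xs)) < card A" using more_objects by simp
  then show ?thesis by (metis Diff_eq_empty_iff List.finite_set card_mono finite_imageI leD)
qed

text \<open>The next dictator owns every remaining object, so all remaining agents, herself
  included, point to her.\<close>

lemma dictators_cyclic:
  assumes "dictators xs" "P \<in> profs" "m < length xs" "B \<subseteq> A" "B \<noteq> {}"
  shows "ttc_cyclic prio a0 P (N - set (take m xs)) B = {xs ! m}"
proof -
  have tgt: "target P (N - set (take m xs)) B x = xs ! m" if "x \<in> N" for x
  proof -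
    have "best (P x) B \<in> B"
      using all_acceptable_best[OF profsD[OF assms(2) that]] assms finite_A
      by (meson finite_subset)
    then show ?thesis using assms unfolding target_def dictators_def by blast
  qed
  have "xs ! m \<in> N" using assms(1,3) unfolding dictators_def by auto
  then have "xs ! m \<in> N - set (take m xs)"
    using assms(1,3) unfolding dictators_def by (auto simp: in_set_conv_nth nth_eq_iff_index_eq)
  then show ?thesis using tgt assms by (intro cyclic_singleton) auto
qed

text \<open>Exactly one dictator leaves per step, so the step number equals the number of dictators
  gone.\<close>

lemma dictators_remaining:
  assumes xs: "dictators xs" and P: "P \<in> profs"
  shows "m \<le> length xs \<Longrightarrow> remaining P m = (N - set (take m xs), A - f P ` set (take m xs))"
proof (induction m)
  case (Suc m)
  let ?M = "N - set (take m xs)" and ?B = "A - f P ` set (take m xs)"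
  have rem: "remaining P m = (?M, ?B)" using Suc by simp
  have cyc: "ttc_cyclic prio a0 P ?M ?B = {xs ! m}"
    using dictators_cyclic[OF xs P, of m ?B] dictators_objects_left[OF xs, of m "f P"] Suc by auto
  have "xs ! m \<in> N" using xs Suc unfolding dictators_def by auto
  then have "f P (xs ! m) = best (P (xs ! m)) (insert a0 ?B)" using FPTTC_eq rem cyc by auto
  then have "remaining P (Suc m) = (?M - {xs ! m}, ?B - {f P (xs ! m)})"
    using remaining_Suc[OF rem cyc] by simp
  also have "\<dots> = (N - set (take (Suc m) xs), A - f P ` set (take (Suc m) xs))"
    using Suc.prems by (auto simp: take_Suc_conv_app_nth)
  finally show ?case .
qed simp

lemma dictators_choice:
  assumes xs: "dictators xs" and P: "P \<in> profs" and m: "m < length xs"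
  shows "f P (xs ! m) = best (P (xs ! m)) (insert a0 (A - f P ` set (take m xs)))"
proof (rule FPTTC_eq)
  show "remaining P m = (N - set (take m xs), A - f P ` set (take m xs))"
    using dictators_remaining assms by simp
  show "xs ! m \<in> ttc_cyclic prio a0 P (N - set (take m xs)) (A - f P ` set (take m xs))"
    using dictators_cyclic[OF xs P m, of "A - f P ` set (take m xs)"]
      dictators_objects_left[OF xs, of m "f P"] m by auto
  show "xs ! m \<in> N" using xs m unfolding dictators_def by auto
qed

lemma dictators_serial:
  assumes "dictators xs" "set xs = N"
  shows "serial_dictatorship N A a0 (\<lambda>_. prefs) f"
proof -
  have "distinct xs" using assms(1) unfolding dictators_def by blast
  then show ?thesis
    unfolding serial_dictatorship_def using assms(2) dictators_choice[OF assms(1)] by blast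
qed

end

section \<open>Remaining agents owning different objects\<close>

text \<open>After the dictators \<open>xs\<close> have left with \<open>cs\<close>, agent \<open>i\<close> owns \<open>a\<close> and \<open>c\<close>, and agent \<open>j\<close>
  owns \<open>b\<close>. The other agents ask for \<open>b\<close> first: they cannot leave before \<open>j\<close>, and if one of them
  inherits \<open>c\<close>, she trades it with \<open>j\<close>.\<close>

locale contested = market N A a0 prio
  for N :: "'i set" and A :: "'a set" and a0 :: 'a and prio :: "'a \<Rightarrow> 'i rel" +
  fixes xs :: "'i list" and i j :: 'i and a b c :: 'a and cs :: "'a list"
  assumes xs: "dictators xs"
    and i: "i \<in> N - set xs" and j: "j \<in> N - set xs" and ij: "i \<noteq> j"
    and abc: "a \<in> A" "b \<in> A" "c \<in> A" "distinct [a, b, c]"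
    and owner: "best (prio a) (N - set xs) = i" "best (prio c) (N - set xs) = i"
      "best (prio b) (N - set xs) = j"
    and cs: "distinct cs" "length cs = length xs" "set cs \<subseteq> A - {a, b, c}"
begin

abbreviation "M \<equiv> N - set xs"
abbreviation "B \<equiv> A - set cs"

text \<open>Only the preferences of \<open>i\<close> and \<open>j\<close> stay open. The objects
  \<open>cs\<close> asked for by the dictators avoid \<open>a\<close>, \<open>b\<close>,
  \<open>c\<close>, so these three are still present when \<open>i\<close> and \<open>j\<close>
  compete.\<close>

definition background :: "('i \<Rightarrow> 'a rel) \<Rightarrow> bool" where
  "background P \<longleftrightarrow> P \<in> profs \<and> (\<forall>m<length xs. ranks A a0 [cs ! m] (P (xs ! m))) \<and>
     (\<forall>x\<in>M - {i, j}. ranks A a0 [b] (P x))"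

lemma backgroundD:
  assumes "background P"
  shows "P \<in> profs" "m < length xs \<Longrightarrow> ranks A a0 [cs ! m] (P (xs ! m))"
    "x \<in> M \<Longrightarrow> x \<noteq> i \<Longrightarrow> x \<noteq> j \<Longrightarrow> ranks A a0 [b] (P x)"
  using assms unfolding background_def by auto

lemma B: "B \<subseteq> A" "a \<in> B" "b \<in> B" "c \<in> B" "B \<noteq> {}"
  using abc cs by auto

lemma dictators_take:
  assumes P: "background P"
  shows "m < length xs \<Longrightarrow> f P (xs ! m) = cs ! m"
proof (induction m rule: less_induct)
  case (less m)
  have "f P ` set (take m xs) = set (take m cs)"
  proof -
    have "map (f P) (take m xs) = take m cs"
      using less cs(2) by (intro nth_equalityI) auto
    then show ?thesis by (metis set_map)
  qed
  moreover have "cs ! m \<notin> set (take m cs)"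
    using less.prems cs(1,2) by (auto simp: in_set_conv_nth nth_eq_iff_index_eq)
  moreover have "cs ! m \<in> set cs" using less.prems cs(2) by simp
  then have "cs ! m \<in> A" using cs(3) by blast
  ultimately have "best (P (xs ! m)) (insert a0 (A - f P ` set (take m xs))) = cs ! m"
    using backgroundD(2)[OF P less.prems] by (intro ranks_best_first) auto
  then show ?case using dictators_choice[OF xs backgroundD(1)[OF P] less.prems] by simp
qed

lemma contested_remaining:
  assumes P: "background P"
  shows "remaining P (length xs) = (M, B)"
proof -
  have "map (f P) xs = cs" using dictators_take[OF P] cs(2) by (intro nth_equalityI) auto
  then have "f P ` set xs = set cs" by (metis set_map)
  then show ?thesis using dictators_remaining[OF xs backgroundD(1)[OF P], of "length xs"] by simp
qed

lemma target_first:
  assumes "ranks A a0 (y # ts) (P x)" "y \<in> B'" "B' \<subseteq> A"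
  shows "target P M' B' x = best (prio y) M'"
  using ranks_best_first[OF assms(1,2)] assms(3) unfolding target_def by auto

lemma target_second:
  assumes "ranks A a0 (y # z # ts) (P x)" "z \<in> B'" "y \<notin> B'" "B' \<subseteq> A"
  shows "target P M' B' x = best (prio z) M'"
  using ranks_best_second[OF assms(1-3)] assms(4) unfolding target_def by auto

lemma assigned_first:
  assumes "remaining P s = (M', B')" "x \<in> ttc_cyclic prio a0 P M' B'" "M' \<subseteq> N"
    "ranks A a0 (y # ts) (P x)" "y \<in> B'" "B' \<subseteq> A"
  shows "f P x = y"
proof -
  have "x \<in> N" using assms(2,3) unfolding ttc_cyclic_def by blast
  then have "f P x = best (P x) (insert a0 B')" using FPTTC_eq assms(1,2) by blast
  also have "\<dots> = y" using assms by (intro ranks_best_first) auto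
  finally show ?thesis .
qed

lemma assigned_second:
  assumes "remaining P s = (M', B')" "x \<in> ttc_cyclic prio a0 P M' B'" "M' \<subseteq> N"
    "ranks A a0 (y # z # ts) (P x)" "z \<in> B'" "y \<in> A - B'" "B' \<subseteq> A"
  shows "f P x = z"
proof -
  have "x \<in> N" using assms(2,3) unfolding ttc_cyclic_def by blast
  then have "f P x = best (P x) (insert a0 B')" using FPTTC_eq assms(1,2) by blast
  also have "\<dots> = z" using assms a0 by (intro ranks_best_second) auto
  finally show ?thesis .
qed

lemma owner_after:
  assumes "y \<in> A" "best (prio y) M = x" "x \<in> M'" "M' \<subseteq> M"
  shows "best (prio y) M' = x"
  using best_subset[OF prio[OF assms(1)], of M M'] assms finite_N by auto

text \<open>Asking first for an object one owns is a self-loop.\<close>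

lemma owner_keeps:
  assumes P: "background P" and x: "x \<in> M" and y: "y \<in> {a, b, c}" "best (prio y) M = x"
    and r: "ranks A a0 (y # ts) (P x)"
  shows "f P x = y"
proof (rule assigned_first[OF contested_remaining[OF P] _ _ r])
  have "target P M B x = x" using target_first[of y ts P x B M, OF r] y B by auto
  then show "x \<in> ttc_cyclic prio a0 P M B"
    using cyclic_selfI[OF backgroundD(1)[OF P]] x B by blast
qed (use y B in auto)

text \<open>Each asks for an object of the other, which is a cycle of length two.\<close>

lemma trade:
  assumes P: "background P" and ri: "ranks A a0 (b # ts) (P i)" and rj: "ranks A a0 (a # ts') (P j)"
  shows "f P i = b" "f P j = a"
proof -
  have t: "target P M B i = j" "target P M B j = i"
    using target_first[of b ts P i B M, OF ri] target_first[of a ts' P j B M, OF rj] B owner by auto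
  have st: "P \<in> profs" "M \<subseteq> N" "B \<subseteq> A" "B \<noteq> {}" using backgroundD(1)[OF P] B by auto
  have "i \<in> ttc_cyclic prio a0 P M B" "j \<in> ttc_cyclic prio a0 P M B"
    using cyclic_pairI[OF st i j t] cyclic_pairI[OF st j i t(2,1)] by auto
  then show "f P i = b" "f P j = a"
    using assigned_first[OF contested_remaining[OF P] _ _ ri]
      assigned_first[OF contested_remaining[OF P] _ _ rj] B by auto
qed

text \<open>Everyone points to \<open>j\<close>, who leaves alone with \<open>b\<close>. Then
  \<open>i\<close> still owns \<open>a\<close> and \<open>c\<close> and takes her second choice by a
  self-loop.\<close>

lemma i_after_j:
  assumes P: "background P" and ri: "ranks A a0 (b # y # ts) (P i)" and y: "y \<in> {a, c}"
    and rj: "ranks A a0 (b # ts') (P j)"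
  shows "f P i = y"
proof -
  have tgt: "target P M B x = j" if "x \<in> M" for x
  proof -
    consider "x = i" | "x = j" | "x \<noteq> i" "x \<noteq> j" by blast
    then show ?thesis
      using target_first[of b "y # ts" P i B M, OF ri] target_first[of b ts' P j B M, OF rj]
        target_first[of b "[]" P x B M] backgroundD(3)[OF P that] B owner by cases auto
  qed
  then have "ttc_cyclic prio a0 P M B = {j}"
    using cyclic_singleton[of P M B j] backgroundD(1)[OF P] j B by auto
  moreover have "best (P j) (insert a0 B) = b" using B by (intro ranks_best_first[OF rj]) auto
  ultimately have rem: "remaining P (Suc (length xs)) = (M - {j}, B - {b})"
    using remaining_Suc[OF contested_remaining[OF P], of j] by simp
  have yB: "y \<in> B - {b}" "best (prio y) M = i" using y B abc(4) owner by auto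
  have "target P (M - {j}) (B - {b}) i = best (prio y) (M - {j})"
    by (rule target_second[of b y ts P i, OF ri]) (use yB(1) in auto)
  also have "\<dots> = i" by (rule owner_after[OF _ yB(2)]) (use yB(1) i ij in auto)
  finally have tgt': "target P (M - {j}) (B - {b}) i = i" .
  have "i \<in> ttc_cyclic prio a0 P (M - {j}) (B - {b})"
    by (rule cyclic_selfI[OF _ _ _ _ _ tgt']) (use backgroundD(1)[OF P] yB(1) i ij in auto)
  then show ?thesis
    by (rule assigned_second[OF rem _ _ ri]) (use yB(1) abc(2) in auto)
qed

text \<open>First only \<open>i\<close> leaves, with \<open>a\<close>. The new owner of the second
  choice of \<open>j\<close> is either \<open>j\<close> herself or an agent asking for
  \<open>b\<close>, which \<open>j\<close> owns; both cases put \<open>j\<close> on a cycle.\<close>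

lemma j_after_i:
  assumes P: "background P" and ri: "ranks A a0 (a # ts) (P i)"
    and rj: "ranks A a0 (a # y # ts') (P j)" and y: "y \<in> {b, c}"
  shows "f P j = y"
proof -
  have tgt: "target P M B i = i" "target P M B j = i"
    using target_first[of a ts P i B M, OF ri] target_first[of a "y # ts'" P j B M, OF rj] B owner by auto
  have others: "target P M B x = j" if "x \<in> M" "x \<noteq> i" "x \<noteq> j" for x
    using target_first[of b "[]" P x B M] backgroundD(3)[OF P that] B owner by auto
  have "ttc_cyclic prio a0 P M B = {i}"
  proof (rule cyclic_singleton)
    \<comment> \<open>The others point to \<open>j\<close>, and \<open>j\<close> points to
      \<open>i\<close>: two steps.\<close>
    show "target P M B x = i \<or> target P M B (target P M B x) = i" if "x \<in> M" for x
      using tgt others[OF that] by (cases "x = i \<or> x = j") auto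
  qed (use backgroundD(1)[OF P] B i tgt in auto)
  moreover have "best (P i) (insert a0 B) = a" using B by (intro ranks_best_first[OF ri]) auto
  ultimately have rem: "remaining P (Suc (length xs)) = (M - {i}, B - {a})"
    using remaining_Suc[OF contested_remaining[OF P], of i] by simp
  have yB: "y \<in> B - {a}" using y B abc(4) by auto
  have st: "P \<in> profs" "M - {i} \<subseteq> N" "B - {a} \<subseteq> A" "B - {a} \<noteq> {}"
    using backgroundD(1)[OF P] yB by auto
  have jM: "j \<in> M - {i}" using j ij by auto
  \<comment> \<open>For \<open>y = c\<close> this is the agent who inherits \<open>c\<close> from
    \<open>i\<close>; nothing is assumed about who that is.\<close>
  define k where "k = best (prio y) (M - {i})"
  have kM: "k \<in> M - {i}"
    unfolding k_def by (rule best_in[OF prio[of y]]) (use finite_N jM yB in auto)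
  have jk: "target P (M - {i}) (B - {a}) j = k"
    unfolding k_def by (rule target_second[of a y ts' P j, OF rj]) (use yB in auto)
  have "j \<in> ttc_cyclic prio a0 P (M - {i}) (B - {a})"
  proof (cases "k = j")
    case True
    then show ?thesis using cyclic_selfI[OF st jM] jk by simp
  next
    case False
    have rk: "ranks A a0 [b] (P k)" using backgroundD(3)[OF P, of k] kM False by auto
    have "target P (M - {i}) (B - {a}) k = best (prio b) (M - {i})"
      by (rule target_first[of b "[]" P k, OF rk]) (use B abc(4) in auto)
    also have "\<dots> = j" using owner_after[OF abc(2) owner(3), of "M - {i}"] jM by blast
    finally show ?thesis using cyclic_pairI[OF st jM kM jk] by simp
  qed
  then show ?thesis
    by (rule assigned_second[OF rem _ _ rj]) (use yB abc in auto)
qed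

end


section \<open>The contradiction when owners differ\<close>

text \<open>Whichever way the preferences of \<open>i\<close> or of \<open>j\<close> are separated
  at the first split, some action consistent with the true preference can yield a worse object than
  a deviation can yield against another preference of the opponent.\<close>

lemma (in contested) not_SOSP_implementable:
  "\<not> SOSP_implementable N A a0 (\<lambda>_. prefs) f"
proof
  assume "SOSP_implementable N A a0 (\<lambda>_. prefs) f"
  then obtain G :: "(nat, 'i, 'a) mechanism" where G: "is_mechanism N A a0 (\<lambda>_. prefs) G"
    "SOSP N (\<lambda>_. prefs) G" and out: "\<And>P. P \<in> profs \<Longrightarrow> outcome G P = f P"
    unfolding SOSP_implementable_def by auto
  define rk where "rk ts = (SOME P. ranks A a0 ts P)" for ts
  have rk: "ranks A a0 ts (rk ts)" if "distinct ts" "set ts \<subseteq> A" for ts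
    unfolding rk_def using ranks_exists[OF finite_A a0 that] by (rule someI_ex)
  \<comment> \<open>The orders \<open>p\<close> and \<open>r\<close> are shared by both agents;
    \<open>q\<close> is only for \<open>i\<close> and \<open>t\<close> only for
    \<open>j\<close>.\<close>
  define p q r t where "p = rk [b, a, c]" and "q = rk [b, c, a]" and "r = rk [a, b, c]"
    and "t = rk [a, c, b]"
  have p: "ranks A a0 [b, a, c] p" and q: "ranks A a0 [b, c, a] q"
    and r: "ranks A a0 [a, b, c] r" and t: "ranks A a0 [a, c, b] t"
    unfolding p_def q_def r_def t_def by (rule rk; use abc in auto)+
  \<comment> \<open>The lookup pairs each dictator with the entry of \<open>cs\<close> at her
    position.\<close>
  define base where "base x = (if x \<in> set xs then rk [the (map_of (zip xs cs) x)] else rk [b])" for x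
  define Q where "Q x = (if x = i then {p, q, r} else if x = j then {p, r, t} else {base x})" for x
  have base_xs: "ranks A a0 [cs ! m] (base (xs ! m))" if "m < length xs" for m
  proof -
    have "map_of (zip xs cs) (xs ! m) = Some (cs ! m)"
      using that xs cs(2) unfolding dictators_def by (intro map_of_zip_nth) auto
    then have "base (xs ! m) = rk [cs ! m]" using that unfolding base_def by simp
    moreover have "cs ! m \<in> set cs" using that cs(2) by simp
    then have "cs ! m \<in> A" using cs(3) by blast
    ultimately show ?thesis using rk[of "[cs ! m]"] by simp
  qed
  have base_other: "ranks A a0 [b] (base x)" if "x \<notin> set xs" for x
    using rk[of "[b]"] that abc(2) unfolding base_def by simp
  have "base x \<in> prefs" if "x \<in> N" for x
  proof (cases "x \<in> set xs")
    case True
    then obtain m where "m < length xs" "x = xs ! m" by (metis in_set_conv_nth)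
    then show ?thesis using base_xs[of m] unfolding ranks_def by simp
  next
    case False
    then show ?thesis using base_other[of x] unfolding ranks_def by simp
  qed
  then have Q: "Q x \<subseteq> prefs" if "x \<in> N" for x
    using that p q r t unfolding Q_def ranks_def by simp
  have bg: "background P" if P: "P \<in> profiles N Q" for P
  proof -
    have PQ: "P x \<in> Q x" if "x \<in> N" for x using P that unfolding profiles_def by (rule PiE_mem)
    have "P \<in> profs" using P Q unfolding profiles_def by blast
    moreover have "ranks A a0 [cs ! m] (P (xs ! m))" if m: "m < length xs" for m
    proof -
      have "xs ! m \<in> set xs" using m by simp
      then have "xs ! m \<in> N" "xs ! m \<noteq> i" "xs ! m \<noteq> j"
        using i j xs unfolding dictators_def by auto
      then show ?thesis using PQ[of "xs ! m"] base_xs[OF m] unfolding Q_def by simp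
    qed
    moreover have "ranks A a0 [b] (P x)" if "x \<in> M - {i, j}" for x
      using that PQ[of x] base_other[of x] unfolding Q_def by simp
    ultimately show ?thesis unfolding background_def by blast
  qed
  \<comment> \<open>First argument: the preference of \<open>i\<close>; second: that of
    \<open>j\<close>.\<close>
  define mk where "mk y z = (\<lambda>x\<in>N. if x = i then y else if x = j then z else base x)" for y z
  have mk: "mk y z \<in> profiles N Q" "mk y z i = y" "mk y z j = z"
    if "y \<in> {p, q, r}" "z \<in> {p, r, t}" for y z
    using that i j ij unfolding mk_def profiles_def Q_def by auto
  have o: "outcome G (mk y z) = f (mk y z)" if "y \<in> {p, q, r}" "z \<in> {p, r, t}" for y z
    using out backgroundD(1)[OF bg[OF mk(1)[OF that]]] .
  have fi_pp: "outcome G (mk p p) i = a"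
    using i_after_j[OF bg[OF mk(1)], of p p a "[c]" "[a, c]"] p o mk by simp
  have fi_qp: "outcome G (mk q p) i = c"
    using i_after_j[OF bg[OF mk(1)], of q p c "[a]" "[a, c]"] p q o mk by simp
  have fi_qr: "outcome G (mk q r) i = b"
    using trade(1)[OF bg[OF mk(1)], of q r "[c, a]" "[b, c]"] q r o mk by simp
  have fj_pt: "outcome G (mk p t) j = a"
    using trade(2)[OF bg[OF mk(1)], of p t "[a, c]" "[c, b]"] p t o mk by simp
  have fi_rp: "outcome G (mk r p) i = a"
    using owner_keeps[OF bg[OF mk(1)] i _ owner(1), of r p "[b, c]"] r o mk by simp
  have fj_rp: "outcome G (mk r p) j = b"
    using owner_keeps[OF bg[OF mk(1)] j _ owner(3), of r p "[a, c]"] p o mk by simp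
  have fj_rr: "outcome G (mk r r) j = b"
    using j_after_i[OF bg[OF mk(1)], of r r "[b, c]" b "[c]"] r o mk by simp
  have fj_rt: "outcome G (mk r t) j = c"
    using j_after_i[OF bg[OF mk(1)], of r t "[b, c]" c "[b]"] r t o mk by simp
  have two: "mk p p \<in> profiles N Q" "mk q r \<in> profiles N Q"
    "outcome G (mk p p) \<noteq> outcome G (mk q r)"
    using mk(1) fi_pp fi_qr abc(4) by auto
  show False
  proof (rule SOSP_first_split[OF G Q two])
    fix i' y z and lab :: "'a rel \<Rightarrow> nat"
    assume i': "i' \<in> N" "y \<in> Q i'" "z \<in> Q i'" "lab y \<noteq> lab z"
      and weak: "\<And>P P' P''. P \<in> profiles N Q \<Longrightarrow> P' \<in> profiles N Q \<Longrightarrow> P'' \<in> profiles N Q \<Longrightarrow>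
        lab (P i') = lab (P' i') \<Longrightarrow> lab (P i') \<noteq> lab (P'' i') \<Longrightarrow>
        weakly_prefers (P i') (outcome G P' i') (outcome G P'' i')"
    \<comment> \<open>Every other agent has a single preference in \<open>Q\<close>, which cannot be
      split.\<close>
    have "i' = i \<or> i' = j" using i' unfolding Q_def by (auto split: if_splits)
    then show False
    proof
      assume "i' = i"
      note weak = weak[unfolded this]
      have split: "lab p \<noteq> lab q \<or> lab p \<noteq> lab r" using i' \<open>i' = i\<close> unfolding Q_def by auto
      show False
      proof (cases "lab p = lab q")
        case True
        \<comment> \<open>Here \<open>p\<close> and \<open>q\<close> share an action apart from
          \<open>r\<close>. With \<open>j\<close> at \<open>p\<close>, this action can yield
          \<open>c\<close> (under \<open>q\<close>), while that of \<open>r\<close> yields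
          \<open>a\<close>.\<close>
        then have "weakly_prefers p c a"
          using weak[OF mk(1) mk(1) mk(1), of p p q p r p] split mk fi_qp fi_rp by simp
        then show False using ranks_not_weakly_prefers[OF p, of 1 c] abc by auto
      next
        case False
        \<comment> \<open>With \<open>p\<close> and \<open>q\<close> apart, \<open>p\<close> yields
          only \<open>a\<close> against \<open>p\<close>, while the action of \<open>q\<close>
          yields the top object \<open>b\<close> against \<open>r\<close>.\<close>
        then have "weakly_prefers p a b"
          using weak[OF mk(1) mk(1) mk(1), of p p p p q r] mk fi_pp fi_qr by simp
        then show False using ranks_not_weakly_prefers[OF p, of 0 a] abc by auto
      qed
    next
      assume "i' = j"
      note weak = weak[unfolded this]
      have split: "lab r \<noteq> lab t \<or> lab r \<noteq> lab p"
        using i' \<open>i' = j\<close> ij unfolding Q_def by auto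
      show False
      proof (cases "lab r = lab t")
        case True
        \<comment> \<open>The action shared by \<open>r\<close> and \<open>t\<close> can yield
          \<open>c\<close> (under \<open>t\<close>), while that of \<open>p\<close> secures the
          owned object \<open>b\<close>, both with \<open>i\<close> at \<open>r\<close>.\<close>
        then have "weakly_prefers r c b"
          using weak[OF mk(1) mk(1) mk(1), of r r r t r p] split mk fj_rt fj_rp by simp
        then show False using ranks_not_weakly_prefers[OF r, of 1 c] abc by auto
      next
        case False
        \<comment> \<open>With \<open>r\<close> and \<open>t\<close> apart, \<open>r\<close> yields
          \<open>b\<close> when \<open>i\<close> has \<open>r\<close>, while the action of
          \<open>t\<close> yields \<open>a\<close> by trade when \<open>i\<close> has
          \<open>p\<close>.\<close>
        then have "weakly_prefers r b a"
          using weak[OF mk(1) mk(1) mk(1), of r r r r p t] mk fj_rr fj_pt by simp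
        then show False using ranks_not_weakly_prefers[OF r, of 0 b] abc by auto
      qed
    qed
  qed
qed


section \<open>SOSP-implementable rules are serial dictatorships\<close>

context market
begin

text \<open>By the pigeonhole principle some remaining agent owns two objects \<open>a\<close> and
  \<open>c\<close>. An object \<open>b\<close> with another owner would give a
  \<open>contested\<close> situation, so this agent owns everything and is the next
  dictator.\<close>

lemma dictators_extend:
  assumes sosp: "SOSP_implementable N A a0 (\<lambda>_. prefs) f"
    and xs: "dictators xs" "set xs \<noteq> N"
  shows "\<exists>x. dictators (xs @ [x])"
proof -
  define owner where "owner a = best (prio a) (N - set xs)" for a
  have sub: "set xs \<subseteq> N" "distinct xs" using xs unfolding dictators_def by auto
  have owner: "owner a \<in> N - set xs" if "a \<in> A" for a
    unfolding owner_def by (rule best_in[OF prio[OF that]]) (use finite_N sub xs(2) in auto)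
  have "card (owner ` A) \<le> card N" using owner finite_N by (intro card_mono) auto
  then have "\<not> inj_on owner A" using more_objects card_image by fastforce
  then obtain a c where ac: "a \<in> A" "c \<in> A" "a \<noteq> c" "owner a = owner c"
    unfolding inj_on_def by blast
  have "owner b = owner a" if b: "b \<in> A" for b
  proof (rule ccontr)
    assume ne: "owner b \<noteq> owner a"
    \<comment> \<open>The dictators and two further agents are at most \<open>card N\<close>, hence
      \<open>card A\<close> is at least \<open>length xs + 3\<close>: besides \<open>a\<close>,
      \<open>b\<close>, \<open>c\<close> there is one object for each dictator.\<close>
    have "card (set xs \<union> {owner a, owner b}) \<le> card N"
      using owner[OF b] owner[OF ac(1)] sub finite_N by (intro card_mono) auto
    moreover have "card (set xs \<union> {owner a, owner b}) = length xs + 2"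
      using owner[OF b] owner[OF ac(1)] sub ne by (subst card_Un_disjoint) (auto simp: distinct_card)
    moreover have "card {a, b, c} \<le> 3" by (simp add: card_insert_if)
    then have "card (A - {a, b, c}) \<ge> card A - 3"
      using diff_card_le_card_Diff[of "{a, b, c}" A] by simp
    ultimately have "length xs \<le> card (A - {a, b, c})" using more_objects by simp
    then obtain C where C: "C \<subseteq> A - {a, b, c}" "card C = length xs"
      by (metis obtain_subset_with_card_n)
    then have "finite C" using finite_A by (meson finite_Diff finite_subset)
    then obtain cs where cs: "set cs = C" "distinct cs" using finite_distinct_list by blast
    have "contested N A a0 prio xs (owner a) (owner b) a b c cs"
    proof
      show "distinct [a, b, c]" using ac ne by auto
      show "length cs = length xs" using cs C distinct_card by metis
    qed (use xs owner[OF b] owner[OF ac(1)] ne b ac cs C in \<open>auto simp: owner_def\<close>)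
    from contested.not_SOSP_implementable[OF this] show False using sosp by simp
  qed
  then have const: "best (prio b) (N - set xs) = owner a" if "b \<in> A" for b
    using that unfolding owner_def by blast
  have "dictators (xs @ [owner a])"
    using xs(1) owner[OF ac(1)] const
    unfolding dictators_def by (auto simp: nth_append less_Suc_eq)
  then show ?thesis by blast
qed

text \<open>Starting from the empty list, the common top segment of the priorities grows until it
  contains all agents.\<close>

lemma SOSP_imp_serial:
  assumes "SOSP_implementable N A a0 (\<lambda>_. prefs) f"
  shows "serial_dictatorship N A a0 (\<lambda>_. prefs) f"
proof -
  have "\<exists>xs. dictators xs \<and> length xs = k" if "k \<le> card N" for k
    using that
  proof (induction k)
    case 0
    then show ?case unfolding dictators_def by simp
  next
    case (Suc k)
    then obtain xs where xs: "dictators xs" "length xs = k" by auto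
    then have "card (set xs) \<noteq> card N"
      using Suc.prems distinct_card unfolding dictators_def by force
    then obtain x where "dictators (xs @ [x])" using dictators_extend[OF assms xs(1)] by blast
    then show ?case using xs(2) by (intro exI[of _ "xs @ [x]"]) simp
  qed
  then obtain xs where xs: "dictators xs" "length xs = card N" by blast
  then have "set xs = N"
    using finite_N card_subset_eq distinct_card unfolding dictators_def by metis
  then show ?thesis using dictators_serial xs(1) by blast
qed

lemma serial_imp_SOSP:
  assumes "serial_dictatorship N A a0 (\<lambda>_. prefs) f"
  shows "SOSP_implementable N A a0 (\<lambda>_. prefs) f"
proof -
  obtain xs where xs: "distinct xs" "set xs = N" "\<forall>P\<in>profs. \<forall>k<length xs.
      f P (xs ! k) = best (P (xs ! k)) (insert a0 (A - f P ` set (take k xs)))"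
    using assms unfolding serial_dictatorship_def by blast
  interpret serial N A a0 "\<lambda>_. prefs" f xs
  proof
    show "f P \<in> extensional N" for P unfolding FPTTC_def by simp
  qed (use finite_A a0 xs all_acceptable_nonempty[OF finite_A a0] in \<open>auto simp: all_acceptable_def\<close>)
  show ?thesis by (rule implementable)
qed

end

theorem corollary5p2:
  fixes n :: nat
    and A :: "'a set"
    and a0 :: 'a
    and prio :: "'a \<Rightarrow> nat rel"
  assumes "finite A"
    and "a0 \<notin> A"
    and "card A > card {1..n}"
    and "\<And>a. a \<in> A \<Longrightarrow> prio a \<in> strict_orders {1..n}"
  shows "SOSP_implementable {1..n} A a0 (\<lambda>i. all_acceptable A a0) (FPTTC {1..n} A a0 prio)
     \<longleftrightarrow> serial_dictatorship {1..n} A a0 (\<lambda>i. all_acceptable A a0) (FPTTC {1..n} A a0 prio)"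
proof -
  interpret market "{1..n}" A a0 prio
    using assms by unfold_locales auto
  show ?thesis using SOSP_imp_serial serial_imp_SOSP by blast
qed

end
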